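(* Let $n\ge1$, $d\ge1$. For $1\le i\le n$ let $P_i(a,b,c)=a^{1/p_i}b^{1/q_i}c^{1/r_i}$ for $a,b,c\ge0$, where $p_i,q_i,r_i\in(1,\infty)$ and $1/p_i+1/q_i+1/r_i=2$. Let $B=\rho(P_1,\dots,P_n)$, where $\rho:[0,\infty)^n\to[0,\infty)$ satisfies, for some constant $C<\infty$, $$\rho(\lambda_1y_1,\dots,\lambda_ny_n)\le C\max_i\lambda_i\;\rho(y_1,\dots,y_n)\quad\text{for all }0<\lambda_i,y_i<\infty,$$ and $$\rho(\vec{y}_1)+\rho(\vec{y}_2)\le\rho(\vec{y}_1+\vec{y}_2)\quad\text{for all }\vec{y}_1,\vec{y}_2\in[0,\infty)^n.$$ Let $\alpha,\beta,\gamma>0$. Then there exist positive constants $\delta_0,c_0,C_0$ and positive functions $\theta,\Theta$ with $$\lim_{t\to\infty}\theta(t)=0,\qquad\lim_{\delta\to0}\Theta(\delta)=0,$$ with the following property. Let $0<\delta\le\delta_0$ and let $f,g,h:\mathbb{R}^d\to[0,\infty)$ be integrable functions with $\int f=\alpha$, $\int g=\beta$, $\int h=\gamma$ and $$I_B(f,g,h)\ge(1-\delta)A\,B(\alpha,\beta,\gamma).$$ Then there exist $k,k',k''\in\mathbb{Z}$ such that $$2^k|\mathcal{F}_k|\ge c_0,\qquad \sum_{|j-k|\ge m}2^j|\mathcal{F}_j|\le\theta(m)+\Theta(\delta)\ \text{ for all positive integers } m,$$ $$2^{k'}|\mathcal{G}_{k'}|\ge c_0,\qquad \sum_{|j-k'|\ge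 m}2^j|\mathcal{G}_j|\le\theta(m)+\Theta(\delta)\ \text{ for all positive integers } m,$$ $$2^{k''}|\mathcal{H}_{k''}|\ge c_0,\qquad \sum_{|j-k''|\ge m}2^j|\mathcal{H}_j|\le\theta(m)+\Theta(\delta)\ \text{ for all positive integers } m,$$ and $$|k-k'|+|k-k''|\le C_0.$$
   Context: For $B:[0,\infty)^3\to[0,\infty)$ measurable, $I_B(f,g,h)=\int_{\mathbb{R}^d}\int_{\mathbb{R}^d}B(f(y),g(x-y),h(x))\,dx\,dy$. The constant $A$ is the optimal (smallest) constant such that $I_B(f,g,h)\le A\,B(\int f,\int g,\int h)$ for all nonnegative integrable $f,g,h$ on $\mathbb{R}^d$. Dyadic decomposition: write $f=\sum_{j\in\mathbb{Z}}2^jF_j$, where $F_j$ vanishes off $\mathcal{F}_j$, $1\le F_j<2$ on $\mathcal{F}_j$, and the sets $\mathcal{F}_j\subset\mathbb{R}^d$ are disjoint; that is, $\mathcal{F}_j=\{x:2^j\le f(x)<2^{j+1}\}$. The sets $\mathcal{G}_j$ and $\mathcal{H}_j$ are defined in the same way from $g$ and $h$: $\mathcal{G}_j=\{2^j\le g<2^{j+1}\}$, $\mathcal{H}_j=\{2^j\le h<2^{j+1}\}$. $|\cdot|$ is Lebesgue measure. *)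

theory Defs
  imports "HOL-Analysis.Analysis"
begin

text \<open>
  Functions with domain \<open>[0,\<infinity>)\<close>, \<open>[0,\<infinity>)\<^sup>3\<close> or \<open>[0,\<infinity>)\<^sup>n\<close> are total functions on real arguments of
  which only the values at nonnegative arguments are used.
\<close>

definition nonneg_integrable :: "(real ^ 'd \<Rightarrow> real) \<Rightarrow> bool" where
  "nonneg_integrable f \<longleftrightarrow> (\<forall>x. 0 \<le> f x) \<and> integrable lebesgue f"

text \<open>
  The double integral is taken in \<open>[0,\<infinity>]\<close>, so that no integrability of the integrand is presupposed.
\<close>

definition I_form ::
  "(real \<Rightarrow> real \<Rightarrow> real \<Rightarrow> real) \<Rightarrow> (real ^ 'd \<Rightarrow> real) \<Rightarrow> (real ^ 'd \<Rightarrow> real) \<Rightarrow> (real ^ 'd \<Rightarrow> real) \<Rightarrow> ennreal"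
  where
  "I_form B f g h =
    (\<integral>\<^sup>+ y. (\<integral>\<^sup>+ x. ennreal (B (f y) (g (x - y)) (h x)) \<partial>lebesgue) \<partial>lebesgue)"

text \<open>
  The comparison is made in \<open>ereal\<close> because \<open>ennreal\<close> would truncate a negative right-hand side to 0.
\<close>

definition admissible_constant ::
  "'d::finite itself \<Rightarrow> (real \<Rightarrow> real \<Rightarrow> real \<Rightarrow> real) \<Rightarrow> real \<Rightarrow> bool" where
  "admissible_constant _ B A \<longleftrightarrow>
    (\<forall>f g h :: real ^ 'd \<Rightarrow> real.
      nonneg_integrable f \<longrightarrow> nonneg_integrable g \<longrightarrow> nonneg_integrable h \<longrightarrow>
      enn2ereal (I_form B f g h) \<le>
        ereal (A * B (integral\<^sup>L lebesgue f) (integral\<^sup>L lebesgue g) (integral\<^sup>L lebesgue h)))"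

text \<open>
  There is no smallest constant if \<open>B\<close> vanishes identically on \<open>[0,\<infinity>)\<^sup>3\<close>: every real number is then
  admissible.
\<close>

definition optimal_constant ::
  "'d::finite itself \<Rightarrow> (real \<Rightarrow> real \<Rightarrow> real \<Rightarrow> real) \<Rightarrow> real \<Rightarrow> bool" where
  "optimal_constant d B A \<longleftrightarrow>
    admissible_constant d B A \<and> (\<forall>A'. admissible_constant d B A' \<longrightarrow> A \<le> A')"

definition dyadic_level :: "(real ^ 'd \<Rightarrow> real) \<Rightarrow> int \<Rightarrow> (real ^ 'd) set" where
  "dyadic_level f j = {x. 2 powi j \<le> f x \<and> f x < 2 powi (j + 1)}"

definition dyadic_mass :: "(real ^ 'd \<Rightarrow> real) \<Rightarrow> int \<Rightarrow> ennreal" where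
  "dyadic_mass f j = ennreal (2 powi j) * emeasure lebesgue (dyadic_level f j)"

end

theory Submission
  imports Defs
begin

text \<open>
  If \<open>s + t + u = 2\<close> with \<open>s, t, u \<in> [0, 1]\<close>, then \<open>a\<^sup>s b\<^sup>t c\<^sup>u \<le> ab + bc + ac\<close>. Since the
  exponents may be perturbed, \<open>B(a, b, c)\<close> times the distance between the dyadic levels of \<open>a\<close>, \<open>b\<close>
  and \<open>c\<close> is still at most a constant times \<open>ab + bc + ac\<close>, and this has a finite double integral
  that depends on the three masses only.

  Two consequences: interactions between distant levels are negligible, and so are
  interactions that involve a level of small mass, so that some three close levels are heavy. Now cut
  \<open>f\<close>, \<open>g\<close>, \<open>h\<close> at level distance \<open>R\<close> from these heavy levels. A pair of levels is
  separated by at most as many radii \<open>R\<close> as its distance, so the cross terms of \<open>n\<close> consecutive radii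
  have a bounded total, and for one of the radii they are at most a constant over \<open>n\<close>. For that radius
  \<open>I(f, g, h)\<close> is almost bounded by \<open>A\<close> times the sum of the two values of \<open>B\<close> at the inner
  and at the outer masses. By superadditivity of \<open>\<rho>\<close> and AM-GM this sum falls short of
  \<open>B(\<alpha>, \<beta>, \<gamma>)\<close> by an amount linear in the outer masses, which are therefore small.
\<close>

subsection \<open>Dyadic levels and weighted means\<close>

text \<open>For \<open>t > 0\<close> this is the index of the dyadic level that contains
  \<open>t\<close>. At other arguments the value carries no meaning and is masked by positivity
  conditions or zero factors.\<close>

definition lev :: "real \<Rightarrow> int" where
  "lev t = \<lfloor>log 2 t\<rfloor>"

lemma lev_eq_iff:
  assumes "0 < t"
  shows "lev t = j \<longleftrightarrow> 2 powi j \<le> t \<and> t < 2 powi (j + 1)"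
  using assms by (simp add: lev_def floor_log_eq_powr_iff powr_real_of_int' flip: powr_real_of_int')

lemma lev_bounds:
  assumes "0 < t"
  shows "2 powi lev t \<le> t" and "t < 2 * 2 powi lev t"
  using lev_eq_iff[OF assms, of "lev t"] by (simp_all add: power_int_add)

lemma mem_dyadic_level_iff: "x \<in> dyadic_level f j \<longleftrightarrow> 0 < f x \<and> lev (f x) = j"
proof (cases "0 < f x")
  case False
  moreover have "(0::real) < 2 powi j" by simp
  ultimately show ?thesis unfolding dyadic_level_def by (smt (verit) mem_Collect_eq)
qed (simp add: dyadic_level_def lev_eq_iff)

text \<open>The extra factor 2 is the width of a dyadic level.\<close>

lemma lev_le_lev:
  assumes "0 < a" "0 < b" "lev a \<le> lev b + int M"
  shows "a \<le> 2 ^ (M + 1) * b"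
proof -
  have "a \<le> 2 * 2 powi lev a" using lev_bounds[OF assms(1)] by simp
  also have "\<dots> \<le> 2 * 2 powi (lev b + int M)"
    using assms(3) by (intro mult_left_mono power_int_increasing) auto
  also have "\<dots> = 2 ^ (M + 1) * 2 powi lev b" by (simp add: power_int_add)
  also have "\<dots> \<le> 2 ^ (M + 1) * b" using lev_bounds[OF assms(2)] by simp
  finally show ?thesis .
qed

text \<open>With \<open>x = ln (a / b)\<close> the level distance is at most
  \<open>x / ln 2 + 1\<close>, where 1 pays for the rounding, and the power is
  \<open>exp (- (e * x))\<close>. The exponential absorbs the linear factor because
  \<open>e * x \<le> exp (e * x)\<close>.\<close>

lemma lev_diff_decay:
  assumes b: "0 < b" and ba: "b \<le> a" and e: "0 < e"
  shows "\<bar>lev a - lev b\<bar> * (b / a) powr e \<le> 1 + 1 / (e * ln 2)"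
proof -
  define x where "x = ln (a / b)"
  have a: "0 < a" using b ba by linarith
  have x: "0 \<le> x" using a b ba by (simp add: x_def)
  have "log 2 b \<le> log 2 a" using a b ba by simp
  then have "\<bar>real_of_int (lev a - lev b)\<bar> \<le> log 2 a - log 2 b + 1"
    unfolding lev_def by linarith
  also have "\<dots> = x / ln 2 + 1" using a b by (simp add: x_def log_def ln_div diff_divide_distrib)
  finally have 1: "\<bar>real_of_int (lev a - lev b)\<bar> \<le> x / ln 2 + 1" .
  have "b / a = exp (- x)" using a b by (simp add: x_def exp_minus)
  then have 2: "(b / a) powr e = exp (- (e * x))" by (simp add: powr_def)
  have "e * x \<le> exp (e * x)" using exp_ge_add_one_self[of "e * x"] by linarith
  then have "e * x * exp (- (e * x)) \<le> 1" by (simp add: exp_minus field_simps)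
  then have 3: "x * exp (- (e * x)) / ln 2 \<le> 1 / (e * ln 2)"
    using e by (simp add: field_simps)
  have "\<bar>lev a - lev b\<bar> * (b / a) powr e \<le> (x / ln 2 + 1) * exp (- (e * x))"
    unfolding 2 using 1 by (intro mult_right_mono) auto
  also have "\<dots> = x * exp (- (e * x)) / ln 2 + exp (- (e * x))" by (simp add: algebra_simps)
  also have "\<dots> \<le> 1 / (e * ln 2) + 1" using 3 x e by (intro add_mono) auto
  finally show ?thesis by simp
qed

section \<open>Weighted AM-GM bounds for monomials of degree two\<close>

lemma weighted_AM_GM3:
  fixes x y z a b c :: real
  assumes "0 < x" "0 < y" "0 < z" "0 \<le> a" "0 \<le> b" "0 \<le> c" "a + b + c = 1"
  shows "x powr a * y powr b * z powr c \<le> a * x + b * y + c * z"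
proof -
  define m where "m = a * x + b * y + c * z"
  have m: "0 < m"
  proof -
    have "0 < a \<or> 0 < b \<or> 0 < c" using assms by linarith
    then show ?thesis unfolding m_def
      using assms by (smt (verit) mult_nonneg_nonneg mult_pos_pos)
  qed
  \<comment> \<open>The tangent line of the concave function \<open>ln\<close> at the weighted mean
    \<open>m\<close>.\<close>
  have l: "ln t \<le> t / m - 1 + ln m" if "0 < t" for t
    using ln_le_minus_one[of "t / m"] that m by (simp add: ln_div)
  have "a * ln x + b * ln y + c * ln z
      \<le> a * (x / m - 1 + ln m) + b * (y / m - 1 + ln m) + c * (z / m - 1 + ln m)"
    using assms l by (intro add_mono mult_left_mono) auto
  also have "\<dots> = (a * x + b * y + c * z) / m + (a + b + c) * (ln m - 1)"
    by (simp add: algebra_simps add_divide_distrib)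
  also have "\<dots> = ln m" using m assms by (simp flip: m_def)
  finally have "exp (a * ln x + b * ln y + c * ln z) \<le> m"
    using m by (metis exp_le_cancel_iff exp_ln)
  then show ?thesis using assms by (simp add: powr_def exp_add m_def)
qed

text \<open>Since the exponents sum to 2, \<open>a = (1 - b) + (1 - c)\<close> and cyclically. The
  monomial is therefore the geometric mean of \<open>y * z\<close>, \<open>x * z\<close>,
  \<open>x * y\<close> with the weights \<open>1 - a\<close>, \<open>1 - b\<close>,
  \<open>1 - c\<close> of sum 1.\<close>

lemma powr_triple_le:
  fixes x y z a b c :: real
  assumes "0 \<le> x" "0 \<le> y" "0 \<le> z" "0 \<le> a" "a \<le> 1" "0 \<le> b" "b \<le> 1" "0 \<le> c" "c \<le> 1" "a + b + c = 2"
  shows "x powr a * y powr b * z powr c \<le> (1 - a) * (y * z) + (1 - b) * (x * z) + (1 - c) * (x * y)"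
proof (cases "x = 0 \<or> y = 0 \<or> z = 0")
  \<comment> \<open>The left side is 0 even if the exponent of the vanishing variable is 0, as
    \<open>0 powr 0 = 0\<close>.\<close>
  case True
  then show ?thesis using assms by auto
next
  case False
  then have pos: "0 < x" "0 < y" "0 < z" using assms by auto
  have e: "a = (1 - b) + (1 - c)" "b = (1 - a) + (1 - c)" "c = (1 - a) + (1 - b)"
    using assms by auto
  have "x powr a * y powr b * z powr c =
      (y * z) powr (1 - a) * (x * z) powr (1 - b) * (x * y) powr (1 - c)"
    unfolding powr_mult using pos
    by (subst (1) e(1), subst (1) e(2), subst (1) e(3)) (simp only: powr_add mult_ac)
  also have "\<dots> \<le> (1 - a) * (y * z) + (1 - b) * (x * z) + (1 - c) * (x * y)"
    using pos assms by (intro weighted_AM_GM3) auto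
  finally show ?thesis .
qed

lemma powr_triple_le_pairs:
  fixes x y z a b c :: real
  assumes "0 \<le> x" "0 \<le> y" "0 \<le> z" "0 \<le> a" "a \<le> 1" "0 \<le> b" "b \<le> 1" "0 \<le> c" "c \<le> 1" "a + b + c = 2"
  shows "x powr a * y powr b * z powr c \<le> x * y + y * z + x * z"
proof -
  have "(1 - a) * (y * z) \<le> 1 * (y * z)" "(1 - b) * (x * z) \<le> 1 * (x * z)"
      "(1 - c) * (x * y) \<le> 1 * (x * y)"
    using assms by (intro mult_right_mono; simp)+
  with powr_triple_le[OF assms] show ?thesis by linarith
qed

text \<open>Here \<open>u\<close>, \<open>v\<close>, \<open>w\<close> are the fractions of three
  masses that a cut retains. As
  \<open>v * w + (1 - v) * (1 - w) = 1 - (v * (1 - w) + w * (1 - v))\<close>, AM-GM for both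
  monomials leaves 1 minus a weighted sum of mixed products, and a mixed product is linear from
  below in the discarded fractions once the retained ones are at least
  \<open>\<eta>\<close>.\<close>

lemma powr_triple_split_le:
  fixes u v w a b c e \<eta> :: real
  assumes e: "0 \<le> e" "e \<le> 1 - a" "e \<le> 1 - b" "e \<le> 1 - c" and abc: "0 \<le> a" "0 \<le> b" "0 \<le> c" "a + b + c = 2"
    and \<eta>: "0 \<le> \<eta>" "\<eta> \<le> u" "u \<le> 1" "\<eta> \<le> v" "v \<le> 1" "\<eta> \<le> w" "w \<le> 1"
  shows "u powr a * v powr b * w powr c + (1 - u) powr a * (1 - v) powr b * (1 - w) powr c
    \<le> 1 - e * \<eta> * ((1 - u) + (1 - v) + (1 - w))"
proof -
  have br: "\<eta> * ((1 - x) + (1 - y)) \<le> x * (1 - y) + y * (1 - x)"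
    if "\<eta> \<le> x" "x \<le> 1" "\<eta> \<le> y" "y \<le> 1" for x y
  proof -
    have "\<eta> * (1 - y) \<le> x * (1 - y)" "\<eta> * (1 - x) \<le> y * (1 - x)"
      using that by (auto intro!: mult_right_mono)
    then show ?thesis by (simp add: algebra_simps)
  qed
  have nn: "0 \<le> \<eta> * ((1 - x) + (1 - y))" if "x \<le> 1" "y \<le> 1" for x y
    using that \<eta> by (intro mult_nonneg_nonneg) auto
  have m: "e * (\<eta> * ((1 - x) + (1 - y))) \<le> l * (x * (1 - y) + y * (1 - x))"
    if "\<eta> \<le> x" "x \<le> 1" "\<eta> \<le> y" "y \<le> 1" "e \<le> l" for x y l
    using that e br nn by (intro mult_mono) auto
  have "u powr a * v powr b * w powr c + (1 - u) powr a * (1 - v) powr b * (1 - w) powr c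
    \<le> ((1 - a) * (v * w) + (1 - b) * (u * w) + (1 - c) * (u * v)) +
      ((1 - a) * ((1 - v) * (1 - w)) + (1 - b) * ((1 - u) * (1 - w)) + (1 - c) * ((1 - u) * (1 - v)))"
    using e abc \<eta> by (intro add_mono powr_triple_le) auto
  also have "\<dots> = (3 - (a + b + c)) - (1 - a) * (v * (1 - w) + w * (1 - v))
      - (1 - b) * (u * (1 - w) + w * (1 - u)) - (1 - c) * (u * (1 - v) + v * (1 - u))"
    by (simp add: algebra_simps)
  also have "\<dots> \<le> 1 - e * (\<eta> * ((1 - v) + (1 - w))) - e * (\<eta> * ((1 - u) + (1 - w)))
      - e * (\<eta> * ((1 - u) + (1 - v)))"
    using m[of v w "1 - a"] m[of u w "1 - b"] m[of u v "1 - c"] e abc \<eta> by linarith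
  \<comment> \<open>Each discarded fraction occurs in two of the three brackets; one of the two
    copies of the loss is enough.\<close>
  also have "\<dots> = 1 - e * \<eta> * ((1 - u) + (1 - v) + (1 - w)) - e * (\<eta> * ((1 - u) + (1 - v) + (1 - w)))"
    by (simp add: algebra_simps)
  also have "\<dots> \<le> 1 - e * \<eta> * ((1 - u) + (1 - v) + (1 - w))"
    using e \<eta> by simp
  finally show ?thesis .
qed

subsection \<open>Integrals over dyadic levels\<close>

lemma lev_measurable [measurable]: "lev \<in> measurable borel (count_space UNIV)"
  unfolding lev_def by measurable

section \<open>Measure-preserving changes of variables in the double integral\<close>

lemma nn_integral_lborel_translate:
  fixes F :: "'a::euclidean_space \<Rightarrow> ennreal"
  assumes [measurable]: "F \<in> borel_measurable borel"
  shows "(\<integral>\<^sup>+x. F (x - y) \<partial>lborel) = (\<integral>\<^sup>+x. F x \<partial>lborel)"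
proof -
  have "(\<integral>\<^sup>+x. F x \<partial>lborel) = (\<integral>\<^sup>+x. F x \<partial>distr lborel borel ((+) (- y)))"
    by (simp add: lborel_distr_plus)
  also have "\<dots> = (\<integral>\<^sup>+x. F (x - y) \<partial>lborel)"
    by (subst nn_integral_distr) (simp_all add: add.commute)
  finally show ?thesis by simp
qed

lemma nn_integral_lborel_reflect:
  fixes F :: "'a::euclidean_space \<Rightarrow> ennreal"
  assumes [measurable]: "F \<in> borel_measurable borel"
  shows "(\<integral>\<^sup>+y. F (x - y) \<partial>lborel) = (\<integral>\<^sup>+y. F y \<partial>lborel)"
proof -
  have "(\<integral>\<^sup>+y. F y \<partial>lborel) =
      (\<integral>\<^sup>+y. F y \<partial>density (distr lborel borel (\<lambda>y. x + (-1) *\<^sub>R y)) (\<lambda>_. ennreal (\<bar>-1\<bar> ^ DIM('a))))"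
    by (subst lborel_affine[of "-1" x]) auto
  also have "\<dots> = (\<integral>\<^sup>+y. F (x - y) \<partial>lborel)"
    by (simp add: nn_integral_density nn_integral_distr)
  finally show ?thesis by simp
qed

text \<open>With \<open>z = (y, x)\<close>, any two of \<open>y\<close>, \<open>x - y\<close>,
  \<open>x\<close> are measure-preserving coordinates of the plane of variables. The second identity
  integrates over \<open>x\<close> first and uses a translation, the third over \<open>y\<close>
  first and uses a reflection.\<close>

lemma nn_integral_lborel_pair:
  fixes F G :: "'a::euclidean_space \<Rightarrow> ennreal"
  assumes [measurable]: "F \<in> borel_measurable borel" "G \<in> borel_measurable borel"
  shows "(\<integral>\<^sup>+z. F (fst z) * G (snd z) \<partial>(lborel \<Otimes>\<^sub>M lborel)) = (\<integral>\<^sup>+x. F x \<partial>lborel) * (\<integral>\<^sup>+x. G x \<partial>lborel)"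
    and "(\<integral>\<^sup>+z. F (fst z) * G (snd z - fst z) \<partial>(lborel \<Otimes>\<^sub>M lborel)) = (\<integral>\<^sup>+x. F x \<partial>lborel) * (\<integral>\<^sup>+x. G x \<partial>lborel)"
    and "(\<integral>\<^sup>+z. F (snd z - fst z) * G (snd z) \<partial>(lborel \<Otimes>\<^sub>M lborel)) = (\<integral>\<^sup>+x. F x \<partial>lborel) * (\<integral>\<^sup>+x. G x \<partial>lborel)"
proof -
  show "(\<integral>\<^sup>+z. F (fst z) * G (snd z) \<partial>(lborel \<Otimes>\<^sub>M lborel)) = (\<integral>\<^sup>+x. F x \<partial>lborel) * (\<integral>\<^sup>+x. G x \<partial>lborel)"
    by (subst lborel.nn_integral_fst[symmetric])
      (simp_all add: nn_integral_cmult nn_integral_multc)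
  show "(\<integral>\<^sup>+z. F (fst z) * G (snd z - fst z) \<partial>(lborel \<Otimes>\<^sub>M lborel)) = (\<integral>\<^sup>+x. F x \<partial>lborel) * (\<integral>\<^sup>+x. G x \<partial>lborel)"
    by (subst lborel.nn_integral_fst[symmetric])
      (simp_all add: nn_integral_cmult nn_integral_multc nn_integral_lborel_translate)
  show "(\<integral>\<^sup>+z. F (snd z - fst z) * G (snd z) \<partial>(lborel \<Otimes>\<^sub>M lborel)) = (\<integral>\<^sup>+x. F x \<partial>lborel) * (\<integral>\<^sup>+x. G x \<partial>lborel)"
    by (subst lborel_pair.nn_integral_snd[symmetric])
      (simp_all add: nn_integral_cmult nn_integral_multc nn_integral_lborel_reflect)
qed

lemma dyadic_level_sets [measurable]:
  fixes f :: "real ^ 'd \<Rightarrow> real"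
  assumes [measurable]: "f \<in> borel_measurable borel"
  shows "dyadic_level f j \<in> sets borel"
  unfolding dyadic_level_def by measurable

lemma dyadic_mass_eq_lborel:
  fixes f :: "real ^ 'd \<Rightarrow> real"
  assumes "f \<in> borel_measurable borel"
  shows "dyadic_mass f j = ennreal (2 powi j) * emeasure lborel (dyadic_level f j)"
  using dyadic_level_sets[OF assms, of j] by (simp add: dyadic_mass_def)

lemma dyadic_mass_le:
  fixes f :: "real ^ 'd \<Rightarrow> real"
  assumes [measurable]: "f \<in> borel_measurable borel"
  shows "dyadic_mass f j \<le> (\<integral>\<^sup>+x. ennreal (f x) * indicator (dyadic_level f j) x \<partial>lborel)"
proof -
  have "dyadic_mass f j = (\<integral>\<^sup>+x. ennreal (2 powi j) * indicator (dyadic_level f j) x \<partial>lborel)"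
    by (simp add: dyadic_mass_eq_lborel nn_integral_cmult_indicator)
  also have "\<dots> \<le> (\<integral>\<^sup>+x. ennreal (f x) * indicator (dyadic_level f j) x \<partial>lborel)"
    by (intro nn_integral_mono) (auto simp: indicator_def dyadic_level_def intro!: ennreal_leI)
  finally show ?thesis .
qed

lemma nn_integral_dyadic_level_le:
  fixes f :: "real ^ 'd \<Rightarrow> real"
  assumes [measurable]: "f \<in> borel_measurable borel"
  shows "(\<integral>\<^sup>+x. ennreal (f x) * indicator (dyadic_level f j) x \<partial>lborel) \<le> 2 * dyadic_mass f j"
proof -
  have "(\<integral>\<^sup>+x. ennreal (f x) * indicator (dyadic_level f j) x \<partial>lborel)
      \<le> (\<integral>\<^sup>+x. ennreal (2 * 2 powi j) * indicator (dyadic_level f j) x \<partial>lborel)"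
    by (intro nn_integral_mono)
      (auto simp: indicator_def dyadic_level_def power_int_add intro!: ennreal_leI)
  also have "\<dots> = ennreal (2 * 2 powi j) * emeasure lborel (dyadic_level f j)"
    by (rule nn_integral_cmult_indicator) simp
  also have "\<dots> = 2 * dyadic_mass f j"
    by (simp add: dyadic_mass_eq_lborel ennreal_mult' mult_ac)
  finally show ?thesis .
qed

text \<open>The levels are disjoint, so at each point at most one term of a finite partial sum is
  nonzero, and that term is \<open>f x\<close>. In \<open>ennreal\<close> a bound for all finite
  partial sums bounds the infinite sum.\<close>

lemma infsum_dyadic_mass_le:
  fixes f :: "real ^ 'd \<Rightarrow> real"
  assumes [measurable]: "f \<in> borel_measurable borel"
  shows "(\<Sum>\<^sub>\<infinity>j\<in>S. dyadic_mass f j)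
    \<le> (\<integral>\<^sup>+x. (if 0 < f x \<and> lev (f x) \<in> S then ennreal (f x) else 0) \<partial>lborel)"
proof (rule infsum_le_finite_sums)
  fix F assume F: "finite F" "F \<subseteq> S"
  have "(\<Sum>j\<in>F. dyadic_mass f j) \<le> (\<Sum>j\<in>F. \<integral>\<^sup>+x. ennreal (f x) * indicator (dyadic_level f j) x \<partial>lborel)"
    by (intro sum_mono dyadic_mass_le) simp
  also have "\<dots> = (\<integral>\<^sup>+x. (\<Sum>j\<in>F. ennreal (f x) * indicator (dyadic_level f j) x) \<partial>lborel)"
    by (subst nn_integral_sum) auto
  also have "\<dots> \<le> (\<integral>\<^sup>+x. (if 0 < f x \<and> lev (f x) \<in> S then ennreal (f x) else 0) \<partial>lborel)"
  proof (intro nn_integral_mono)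
    fix x
    have "(\<Sum>j\<in>F. ennreal (f x) * indicator (dyadic_level f j) x) =
        (\<Sum>j\<in>F. if j = lev (f x) then (if 0 < f x then ennreal (f x) else 0) else 0)"
      by (intro sum.cong) (auto simp: indicator_def mem_dyadic_level_iff)
    also have "\<dots> = (if 0 < f x \<and> lev (f x) \<in> F then ennreal (f x) else 0)"
      using F(1) by simp
    also have "\<dots> \<le> (if 0 < f x \<and> lev (f x) \<in> S then ennreal (f x) else 0)"
      using F(2) by auto
    finally show "(\<Sum>j\<in>F. ennreal (f x) * indicator (dyadic_level f j) x)
      \<le> (if 0 < f x \<and> lev (f x) \<in> S then ennreal (f x) else 0)" .
  qed
  finally show "(\<Sum>j\<in>F. dyadic_mass f j)
    \<le> (\<integral>\<^sup>+x. (if 0 < f x \<and> lev (f x) \<in> S then ennreal (f x) else 0) \<partial>lborel)" .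
qed (rule nonneg_summable_on_complete, simp)

text \<open>The part of \<open>f\<close> on the levels near \<open>l\<close> whose dyadic mass is
  small. The centre \<open>l\<close> is a parameter because it will be the level of another function
  at another point.\<close>

definition light :: "(real ^ 'd \<Rightarrow> real) \<Rightarrow> real \<Rightarrow> nat \<Rightarrow> int \<Rightarrow> real ^ 'd \<Rightarrow> ennreal" where
  "light f c M l x = (if 0 < f x \<and> \<bar>lev (f x) - l\<bar> \<le> int M \<and> dyadic_mass f (lev (f x)) < ennreal c
    then ennreal (f x) else 0)"

lemma light_measurable:
  fixes f :: "real ^ 'd \<Rightarrow> real"
  assumes f [measurable]: "f \<in> borel_measurable borel"
    and [measurable]: "l \<in> measurable N (count_space UNIV)" "\<phi> \<in> measurable N borel"
  shows "(\<lambda>z. light f c M (l z) (\<phi> z)) \<in> borel_measurable N"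
proof -
  have [measurable]: "(\<lambda>z. dyadic_mass f (lev (f (\<phi> z)))) \<in> borel_measurable N"
    by (rule measurable_compose[where g = "dyadic_mass f" and N = "count_space UNIV"]) auto
  have [measurable]: "(\<lambda>z. real_of_int (l z)) \<in> borel_measurable N"
      "(\<lambda>z. real_of_int (lev (f (\<phi> z)))) \<in> borel_measurable N"
    by (rule measurable_compose[where g = real_of_int and N = "count_space UNIV"]; simp)+
  \<comment> \<open>Restated over the reals, where the measurability rules apply.\<close>
  have "(\<bar>i - j\<bar> \<le> int M) = (\<bar>real_of_int i - real_of_int j\<bar> \<le> real M)" for i j
    by linarith
  then show ?thesis unfolding light_def by simp
qed

text \<open>At most \<open>2 * M + 1\<close> levels lie within \<open>M\<close> of \<open>l\<close>,
  and the integral over a level is at most twice its dyadic mass.\<close>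

lemma nn_integral_light_le:
  fixes f :: "real ^ 'd \<Rightarrow> real"
  assumes f [measurable]: "f \<in> borel_measurable borel"
  shows "(\<integral>\<^sup>+x. light f c M l x \<partial>lborel) \<le> ennreal (2 * (2 * real M + 1) * c)"
proof -
  define J where "J = {j \<in> {l - int M..l + int M}. dyadic_mass f j < ennreal c}"
  have J: "finite J" "card J \<le> 2 * M + 1"
  proof -
    have "card J \<le> card {l - int M..l + int M}" unfolding J_def by (intro card_mono) auto
    then show "card J \<le> 2 * M + 1" by simp
    show "finite J" unfolding J_def by (rule finite_subset[of _ "{l - int M..l + int M}"]) auto
  qed
  have "(\<integral>\<^sup>+x. light f c M l x \<partial>lborel)
      \<le> (\<integral>\<^sup>+x. (\<Sum>j\<in>J. ennreal (f x) * indicator (dyadic_level f j) x) \<partial>lborel)"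
  proof (intro nn_integral_mono)
    fix x
    show "light f c M l x \<le> (\<Sum>j\<in>J. ennreal (f x) * indicator (dyadic_level f j) x)"
    proof (cases "0 < f x \<and> \<bar>lev (f x) - l\<bar> \<le> int M \<and> dyadic_mass f (lev (f x)) < ennreal c")
      case True
      then have "lev (f x) \<in> J" by (auto simp: J_def)
      have "light f c M l x = ennreal (f x) * indicator (dyadic_level f (lev (f x))) x"
        using True by (simp add: light_def mem_dyadic_level_iff)
      also have "\<dots> \<le> (\<Sum>j\<in>J. ennreal (f x) * indicator (dyadic_level f j) x)"
        using \<open>lev (f x) \<in> J\<close> J(1) by (intro member_le_sum) auto
      finally show ?thesis .
    qed (auto simp: light_def)
  qed
  also have "\<dots> = (\<Sum>j\<in>J. \<integral>\<^sup>+x. ennreal (f x) * indicator (dyadic_level f j) x \<partial>lborel)"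
    by (subst nn_integral_sum) auto
  also have "\<dots> \<le> (\<Sum>j\<in>J. ennreal (2 * c))"
  proof (intro sum_mono)
    fix j assume "j \<in> J"
    have "(\<integral>\<^sup>+x. ennreal (f x) * indicator (dyadic_level f j) x \<partial>lborel) \<le> 2 * dyadic_mass f j"
      by (intro nn_integral_dyadic_level_le f)
    also have "\<dots> \<le> 2 * ennreal c"
      using \<open>j \<in> J\<close> by (intro mult_left_mono) (auto simp: J_def)
    also have "\<dots> = ennreal (2 * c)" by (simp add: ennreal_mult')
    finally show "(\<integral>\<^sup>+x. ennreal (f x) * indicator (dyadic_level f j) x \<partial>lborel) \<le> ennreal (2 * c)" .
  qed
  also have "\<dots> = of_nat (card J) * ennreal (2 * c)" by simp
  also have "\<dots> \<le> of_nat (2 * M + 1) * ennreal (2 * c)"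
    using J(2) by (intro mult_right_mono of_nat_mono) auto
  also have "\<dots> = ennreal (2 * (2 * real M + 1) * c)"
    unfolding ennreal_of_nat_eq_real_of_nat by (subst ennreal_mult'[symmetric]) (auto simp: algebra_simps)
  finally show ?thesis .
qed

subsection \<open>Pointwise bounds for the integrand\<close>

text \<open>The functions \<open>s\<close>, \<open>t\<close>, \<open>u\<close> stand for the
  reciprocals of the exponents \<open>p\<close>, \<open>q\<close>, \<open>r\<close>. Minimality of
  \<open>A\<close> excludes a form that vanishes identically; admissibility of \<open>A\<close>
  enters the estimates.\<close>

locale convolution_form =
  fixes \<rho> :: "real ^ 'n \<Rightarrow> real"
    and s t u :: "'n \<Rightarrow> real"
    and B :: "real \<Rightarrow> real \<Rightarrow> real \<Rightarrow> real"
    and C A :: real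
    and dim :: "'d::finite itself"
  assumes exponents: "\<And>i. 0 < s i \<and> s i < 1 \<and> 0 < t i \<and> t i < 1 \<and> 0 < u i \<and> u i < 1 \<and> s i + t i + u i = 2"
    and B_eq: "\<And>a b c. 0 \<le> a \<Longrightarrow> 0 \<le> b \<Longrightarrow> 0 \<le> c \<Longrightarrow>
      B a b c = \<rho> (\<chi> i. a powr s i * b powr t i * c powr u i)"
    and B_measurable: "(\<lambda>(a, b, c). B a b c) \<in>
      borel_measurable (restrict_space borel ({0..} \<times> {0..} \<times> {0..}))"
    and \<rho>_nonneg: "\<And>y. (\<forall>i. 0 \<le> y $ i) \<Longrightarrow> 0 \<le> \<rho> y"
    and \<rho>_scaling: "\<And>l y. (\<forall>i. 0 < l $ i) \<Longrightarrow> (\<forall>i. 0 < y $ i) \<Longrightarrow>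
      \<rho> (\<chi> i. l $ i * y $ i) \<le> C * Max (range (\<lambda>i. l $ i)) * \<rho> y"
    and \<rho>_superadditive: "\<And>y z. (\<forall>i. 0 \<le> y $ i) \<Longrightarrow> (\<forall>i. 0 \<le> z $ i) \<Longrightarrow>
      \<rho> y + \<rho> z \<le> \<rho> (y + z)"
    and A: "optimal_constant dim B A"
begin

section \<open>Monotonicity, positivity and scaling of \<open>\<rho>\<close> and
  \<open>B\<close>\<close>

lemma \<rho>_mono:
  assumes "\<forall>i. 0 \<le> y $ i" "\<forall>i. y $ i \<le> z $ i"
  shows "\<rho> y \<le> \<rho> z"
proof -
  have "\<rho> y + \<rho> (z - y) \<le> \<rho> (y + (z - y))"
    using assms by (intro \<rho>_superadditive) auto
  moreover have "0 \<le> \<rho> (z - y)" using assms by (intro \<rho>_nonneg) auto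
  ultimately show ?thesis by simp
qed

lemma B_nonneg: "0 \<le> a \<Longrightarrow> 0 \<le> b \<Longrightarrow> 0 \<le> c \<Longrightarrow> 0 \<le> B a b c"
  by (simp add: B_eq \<rho>_nonneg)

text \<open>Superadditivity at the origin gives \<open>2 * \<rho> 0 \<le> \<rho> 0\<close>, so
  \<open>\<rho>\<close> vanishes there.\<close>

lemma B_zero:
  assumes "0 \<le> a" "0 \<le> b" "0 \<le> c" "a = 0 \<or> b = 0 \<or> c = 0"
  shows "B a b c = 0"
proof -
  have "(\<chi> i. a powr s i * b powr t i * c powr u i) = 0"
    using assms by (auto simp: vec_eq_iff)
  then have "B a b c = \<rho> 0" using assms by (simp add: B_eq)
  moreover have "\<rho> 0 = 0"
    using \<rho>_superadditive[of 0 0] \<rho>_nonneg[of 0] by simp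
  ultimately show ?thesis by simp
qed

lemma I_form_eq:
  "I_form B f g h = (\<integral>\<^sup>+ y. (\<integral>\<^sup>+ x. ennreal (B (f y) (g (x - y)) (h x)) \<partial>lborel) \<partial>lborel)"
  by (simp add: I_form_def nn_integral_completion)

text \<open>If \<open>\<rho> 1 = 0\<close>, scaling from the vector 1 makes \<open>B\<close> vanish
  on the whole octant. Then \<open>A - 1\<close> is admissible too, against the minimality of
  \<open>A\<close>.\<close>

lemma \<rho>_one_pos: "0 < \<rho> 1"
proof (rule ccontr)
  assume "\<not> 0 < \<rho> 1"
  with \<rho>_nonneg[of 1] have 0: "\<rho> 1 = 0" by simp
  have B0: "B a b c = 0" if "0 \<le> a" "0 \<le> b" "0 \<le> c" for a b c
  proof (cases "a = 0 \<or> b = 0 \<or> c = 0")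
    case False
    then have "\<rho> (\<chi> i. (\<chi> i. a powr s i * b powr t i * c powr u i) $ i * 1 $ i) \<le> 0"
      using \<rho>_scaling[of "\<chi> i. a powr s i * b powr t i * c powr u i" 1] that 0 by simp
    then show ?thesis using that B_nonneg[of a b c] by (simp add: B_eq)
  qed (use that B_zero in auto)
  have "admissible_constant dim B (A - 1)"
    unfolding admissible_constant_def
  proof (intro allI impI)
    fix f g h :: "real ^ 'd \<Rightarrow> real"
    assume fgh: "nonneg_integrable f" "nonneg_integrable g" "nonneg_integrable h"
    then have "I_form B f g h = 0"
      by (simp add: I_form_def nonneg_integrable_def B0)
    then show "enn2ereal (I_form B f g h) \<le> ereal ((A - 1) *
        B (integral\<^sup>L lebesgue f) (integral\<^sup>L lebesgue g) (integral\<^sup>L lebesgue h))"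
      using fgh by (simp add: nonneg_integrable_def B0 zero_ennreal.rep_eq)
  qed
  then show False using A unfolding optimal_constant_def by fastforce
qed

lemma C_ge_1: "1 \<le> C"
  using \<rho>_scaling[of 1 1] \<rho>_one_pos by (simp add: field_simps one_vec_def)

lemma \<rho>_scaling_le:
  assumes "\<forall>i. 0 < l i" "\<forall>i. l i \<le> m" "\<forall>i. 0 < y $ i"
  shows "\<rho> (\<chi> i. l i * y $ i) \<le> C * m * \<rho> y"
proof -
  have "\<rho> (\<chi> i. l i * y $ i) \<le> C * Max (range l) * \<rho> y"
    using \<rho>_scaling[of "\<chi> i. l i" y] assms by simp
  also have "\<dots> \<le> C * m * \<rho> y"
    using assms C_ge_1 \<rho>_nonneg[of y]
    by (intro mult_right_mono mult_left_mono Max.boundedI) (auto simp: less_imp_le)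
  finally show ?thesis .
qed

lemma B_le:
  assumes "0 < a" "0 < b" "0 < c" "\<And>i. a powr s i * b powr t i * c powr u i \<le> m"
  shows "B a b c \<le> C * \<rho> 1 * m"
  using \<rho>_scaling_le[of "\<lambda>i. a powr s i * b powr t i * c powr u i" m 1] assms
  by (simp add: B_eq mult_ac)

text \<open>Scaling is applied backwards, with the factors \<open>1 / y $ i\<close> that lead from
  \<open>y\<close> to the vector 1.\<close>

lemma B_pos:
  assumes "0 < a" "0 < b" "0 < c"
  shows "0 < B a b c"
proof -
  define y where "y = (\<chi> i. a powr s i * b powr t i * c powr u i)"
  have y: "0 < y $ i" for i using assms by (simp add: y_def)
  have "\<rho> 1 = \<rho> (\<chi> i. (1 / y $ i) * y $ i)"
    using y by (simp add: one_vec_def less_imp_neq[THEN not_sym])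
  also have "\<dots> \<le> C * Max (range (\<lambda>i. 1 / y $ i)) * \<rho> y"
    using y by (intro \<rho>_scaling_le) auto
  finally have "\<rho> y \<noteq> 0" using \<rho>_one_pos by auto
  then show ?thesis using B_nonneg[of a b c] assms by (simp add: B_eq flip: y_def)
qed

text \<open>Superadditivity merges the two values of \<open>B\<close> into one value of
  \<open>\<rho>\<close> at a sum of vectors, which is coordinatewise at most
  \<open>(1 - \<kappa>)\<close> times the full vector. A second use of superadditivity, for the
  parts \<open>1 - \<kappa>\<close> and \<open>\<kappa>\<close> of the full vector, gives the
  gain.\<close>

lemma B_split_le:
  assumes abc: "0 < \<alpha>" "0 < \<beta>" "0 < \<gamma>" "0 \<le> a" "a \<le> \<alpha>" "0 \<le> b" "b \<le> \<beta>" "0 \<le> c" "c \<le> \<gamma>"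
    and \<kappa>: "0 \<le> \<kappa>"
    and split: "\<And>i. (a / \<alpha>) powr s i * (b / \<beta>) powr t i * (c / \<gamma>) powr u i +
      (1 - a / \<alpha>) powr s i * (1 - b / \<beta>) powr t i * (1 - c / \<gamma>) powr u i \<le> 1 - \<kappa>"
  shows "B a b c + B (\<alpha> - a) (\<beta> - b) (\<gamma> - c) \<le> (1 - \<kappa> / C) * B \<alpha> \<beta> \<gamma>"
proof -
  define p where "p a b c = (\<chi> i. a powr s i * b powr t i * c powr u i)" for a b c
  have p_nonneg: "0 \<le> p x y z $ i" for x y z i by (simp add: p_def)
  have p_pos: "0 < p \<alpha> \<beta> \<gamma> $ i" for i using abc by (simp add: p_def)
  have part: "p a b c $ i + p (\<alpha> - a) (\<beta> - b) (\<gamma> - c) $ i \<le> (1 - \<kappa>) * p \<alpha> \<beta> \<gamma> $ i" for i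
  proof -
    have 1: "p x y z $ i = (x / \<alpha>) powr s i * (y / \<beta>) powr t i * (z / \<gamma>) powr u i * p \<alpha> \<beta> \<gamma> $ i"
      if "0 \<le> x" "0 \<le> y" "0 \<le> z" for x y z
      using that abc by (simp add: p_def powr_divide)
    have 2: "1 - a / \<alpha> = (\<alpha> - a) / \<alpha>" "1 - b / \<beta> = (\<beta> - b) / \<beta>" "1 - c / \<gamma> = (\<gamma> - c) / \<gamma>"
      using abc by (auto simp: field_simps)
    have "p a b c $ i + p (\<alpha> - a) (\<beta> - b) (\<gamma> - c) $ i =
        ((a / \<alpha>) powr s i * (b / \<beta>) powr t i * (c / \<gamma>) powr u i +
        (1 - a / \<alpha>) powr s i * (1 - b / \<beta>) powr t i * (1 - c / \<gamma>) powr u i) * p \<alpha> \<beta> \<gamma> $ i"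
      using 1[of a b c] 1[of "\<alpha> - a" "\<beta> - b" "\<gamma> - c"] abc by (simp only: 2 distrib_right)
    also have "\<dots> \<le> (1 - \<kappa>) * p \<alpha> \<beta> \<gamma> $ i"
      using split p_nonneg by (intro mult_right_mono)
    finally show ?thesis .
  qed
  \<comment> \<open>Any one coordinate shows this; \<open>undefined\<close> names one.\<close>
  have \<kappa>1: "\<kappa> \<le> 1"
  proof (rule ccontr)
    assume "\<not> \<kappa> \<le> 1"
    with p_pos have "(1 - \<kappa>) * p \<alpha> \<beta> \<gamma> $ undefined < 0" by (simp add: mult_neg_pos)
    with part[of undefined] p_nonneg[of a b c undefined]
      p_nonneg[of "\<alpha> - a" "\<beta> - b" "\<gamma> - c" undefined]
    show False by linarith
  qed
  have "B a b c + B (\<alpha> - a) (\<beta> - b) (\<gamma> - c) = \<rho> (p a b c) + \<rho> (p (\<alpha> - a) (\<beta> - b) (\<gamma> - c))"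
    using abc by (simp add: B_eq p_def)
  also have "\<dots> \<le> \<rho> (p a b c + p (\<alpha> - a) (\<beta> - b) (\<gamma> - c))"
    using p_nonneg by (intro \<rho>_superadditive) auto
  also have "\<dots> \<le> \<rho> (\<chi> i. (1 - \<kappa>) * p \<alpha> \<beta> \<gamma> $ i)"
    using part p_nonneg by (intro \<rho>_mono) auto
  finally have 1: "B a b c + B (\<alpha> - a) (\<beta> - b) (\<gamma> - c) \<le> \<rho> (\<chi> i. (1 - \<kappa>) * p \<alpha> \<beta> \<gamma> $ i)" .
  \<comment> \<open>The constant \<open>C\<close> is spent on the small part
    \<open>\<kappa>\<close>. Scaling the part \<open>1 - \<kappa>\<close> directly would cost the
    factor \<open>C\<close> on the main term.\<close>
  have 2: "\<kappa> / C * \<rho> (p \<alpha> \<beta> \<gamma>) \<le> \<rho> (\<chi> i. \<kappa> * p \<alpha> \<beta> \<gamma> $ i)"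
  proof (cases "\<kappa> = 0")
    case False
    have "\<rho> (\<chi> i. (1 / \<kappa>) * (\<chi> i. \<kappa> * p \<alpha> \<beta> \<gamma> $ i) $ i) \<le> C * (1 / \<kappa>) * \<rho> (\<chi> i. \<kappa> * p \<alpha> \<beta> \<gamma> $ i)"
      using False \<kappa> p_pos by (intro \<rho>_scaling_le) auto
    then show ?thesis using False \<kappa> C_ge_1 by (simp add: field_simps)
  qed (use \<rho>_nonneg in simp)
  have "\<rho> (\<chi> i. (1 - \<kappa>) * p \<alpha> \<beta> \<gamma> $ i) + \<rho> (\<chi> i. \<kappa> * p \<alpha> \<beta> \<gamma> $ i)
      \<le> \<rho> ((\<chi> i. (1 - \<kappa>) * p \<alpha> \<beta> \<gamma> $ i) + (\<chi> i. \<kappa> * p \<alpha> \<beta> \<gamma> $ i))"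
    using p_nonneg \<kappa> \<kappa>1 by (intro \<rho>_superadditive) auto
  also have "(\<chi> i. (1 - \<kappa>) * p \<alpha> \<beta> \<gamma> $ i) + (\<chi> i. \<kappa> * p \<alpha> \<beta> \<gamma> $ i) = p \<alpha> \<beta> \<gamma>"
    by (simp add: vec_eq_iff algebra_simps)
  finally have "\<rho> (\<chi> i. (1 - \<kappa>) * p \<alpha> \<beta> \<gamma> $ i) \<le> (1 - \<kappa> / C) * \<rho> (p \<alpha> \<beta> \<gamma>)"
    using 2 by (simp add: algebra_simps)
  moreover have "\<rho> (p \<alpha> \<beta> \<gamma>) = B \<alpha> \<beta> \<gamma>" using abc by (simp add: B_eq p_def)
  ultimately show ?thesis using 1 by simp
qed

text \<open>The room in the exponents: each of them can be moved by \<open>\<epsilon>\<close> in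
  either direction without leaving \<open>[0, 1]\<close>.\<close>

definition \<epsilon> :: real where
  "\<epsilon> = Min (\<Union>i. {s i, t i, u i, 1 - s i, 1 - t i, 1 - u i})"

lemma \<epsilon>_pos: "0 < \<epsilon>"
proof -
  have "\<epsilon> \<in> (\<Union>i. {s i, t i, u i, 1 - s i, 1 - t i, 1 - u i})"
    unfolding \<epsilon>_def by (rule Min_in) auto
  then obtain i where "\<epsilon> \<in> {s i, t i, u i, 1 - s i, 1 - t i, 1 - u i}" by blast
  then show ?thesis using exponents[of i] by fastforce
qed

lemma \<epsilon>_le:
  "\<epsilon> \<le> s i" "\<epsilon> \<le> t i" "\<epsilon> \<le> u i" "\<epsilon> \<le> 1 - s i" "\<epsilon> \<le> 1 - t i" "\<epsilon> \<le> 1 - u i"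
  unfolding \<epsilon>_def by (rule Min_le; (simp; fail | blast))+

text \<open>The shifts sum to 0, so the perturbed exponents still sum to 2 and the bound by pairs
  applies to them. The extra factor is the same for every \<open>i\<close>, so it can be divided out
  before the scaling bound for \<open>B\<close>.\<close>

lemma B_le_ratio:
  assumes abc: "0 < a" "0 < b" "0 < c"
    and e: "e1 + e2 + e3 = 0" "\<bar>e1\<bar> \<le> \<epsilon>" "\<bar>e2\<bar> \<le> \<epsilon>" "\<bar>e3\<bar> \<le> \<epsilon>"
  shows "B a b c * (a powr e1 * b powr e2 * c powr e3) \<le> C * \<rho> 1 * (a * b + b * c + a * c)"
proof -
  define w where "w = a powr e1 * b powr e2 * c powr e3"
  have w: "0 < w" using abc by (simp add: w_def)
  have "a powr s i * b powr t i * c powr u i \<le> (a * b + b * c + a * c) / w" for i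
  proof -
    have "a powr (s i + e1) * b powr (t i + e2) * c powr (u i + e3) \<le> a * b + b * c + a * c"
      using abc e \<epsilon>_le[of i] exponents[of i] by (intro powr_triple_le_pairs) auto
    then show ?thesis using w by (simp add: field_simps w_def powr_add)
  qed
  from B_le[OF abc this] show ?thesis
    using w unfolding w_def[symmetric] by (simp add: field_simps)
qed

text \<open>The factor \<open>1 + 1 / (\<epsilon> * ln 2)\<close> is the decay constant for one
  level distance; the 2 accounts for two distances.\<close>

definition K :: real where
  "K = C * \<rho> 1 * (2 * (1 + 1 / (\<epsilon> * ln 2)))"

lemma K_pos: "0 < K"
  using C_ge_1 \<rho>_one_pos \<epsilon>_pos by (simp add: K_def add_pos_pos)

lemma B_le_pairs:
  assumes "0 \<le> a" "0 \<le> b" "0 \<le> c"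
  shows "B a b c \<le> K * (a * b + b * c + a * c)"
proof (cases "0 < a \<and> 0 < b \<and> 0 < c")
  case True
  have "B a b c \<le> C * \<rho> 1 * 1 * (a * b + b * c + a * c)"
    using B_le_ratio[of a b c 0 0 0] True \<epsilon>_pos by simp
  also have "\<dots> \<le> K * (a * b + b * c + a * c)"
    unfolding K_def using True C_ge_1 \<rho>_one_pos \<epsilon>_pos by (intro mult_right_mono mult_left_mono) auto
  finally show ?thesis .
next
  case False
  with assms have "B a b c = 0" by (intro B_zero) auto
  with assms K_pos show ?thesis by simp
qed

text \<open>Raising the exponent of the larger of two values by \<open>\<epsilon>\<close> and
  lowering that of the smaller one gains a power \<open>\<epsilon>\<close> of their ratio, and this
  power absorbs the level distance.\<close>

lemma B_lev_diff_le:
  assumes "0 < a" "0 < b" "0 < c"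
  shows "B a b c * (\<bar>lev a - lev b\<bar> + \<bar>lev a - lev c\<bar>) \<le> K * (a * b + b * c + a * c)"
proof -
  define Q where "Q = C * \<rho> 1 * (a * b + b * c + a * c)"
  have Q: "0 \<le> Q" using assms C_ge_1 \<rho>_one_pos by (simp add: Q_def)
  have aux: "B a b c * \<bar>lev x - lev y\<bar> \<le> Q * (1 + 1 / (\<epsilon> * ln 2))"
    if "0 < y" "y \<le> x" "B a b c * (x / y) powr \<epsilon> \<le> Q" for x y
  proof -
    have x: "0 < x" using that by linarith
    have "B a b c \<le> Q * (y / x) powr \<epsilon>"
      using that x by (simp add: powr_divide field_simps)
    then have "B a b c * \<bar>lev x - lev y\<bar> \<le> Q * (y / x) powr \<epsilon> * \<bar>lev x - lev y\<bar>"
      by (intro mult_right_mono) auto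
    also have "\<dots> = Q * (\<bar>lev x - lev y\<bar> * (y / x) powr \<epsilon>)" by simp
    also have "\<dots> \<le> Q * (1 + 1 / (\<epsilon> * ln 2))"
      using Q that \<epsilon>_pos by (intro mult_left_mono lev_diff_decay)
    finally show ?thesis .
  qed
  \<comment> \<open>Four choices of the shifts, for \<open>a\<close> against \<open>b\<close> and
    \<open>a\<close> against \<open>c\<close> in either order.\<close>
  have r: "B a b c * (a / b) powr \<epsilon> \<le> Q" "B a b c * (b / a) powr \<epsilon> \<le> Q"
      "B a b c * (a / c) powr \<epsilon> \<le> Q" "B a b c * (c / a) powr \<epsilon> \<le> Q"
    using B_le_ratio[OF assms, of \<epsilon> "- \<epsilon>" 0] B_le_ratio[OF assms, of "- \<epsilon>" \<epsilon> 0]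
      B_le_ratio[OF assms, of \<epsilon> 0 "- \<epsilon>"] B_le_ratio[OF assms, of "- \<epsilon>" 0 \<epsilon>] assms \<epsilon>_pos
    by (simp_all add: Q_def powr_divide powr_minus field_simps)
  have 1: "B a b c * \<bar>lev a - lev b\<bar> \<le> Q * (1 + 1 / (\<epsilon> * ln 2))"
    using aux[of b a] aux[of a b] r assms by (cases "b \<le> a") (auto simp: abs_minus_commute)
  have 2: "B a b c * \<bar>lev a - lev c\<bar> \<le> Q * (1 + 1 / (\<epsilon> * ln 2))"
    using aux[of c a] aux[of a c] r assms by (cases "c \<le> a") (auto simp: abs_minus_commute)
  have "B a b c * (\<bar>lev a - lev b\<bar> + \<bar>lev a - lev c\<bar>) \<le> 2 * (Q * (1 + 1 / (\<epsilon> * ln 2)))"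
    using 1 2 by (simp add: distrib_left)
  also have "\<dots> = K * (a * b + b * c + a * c)"
    unfolding Q_def K_def by (simp only: mult_ac)
  finally show ?thesis .
qed

end

subsection \<open>Heavy levels\<close>

context convolution_form
begin

text \<open>Nonnegativity is required because \<open>B\<close> is measurable on the closed octant
  only.\<close>

lemma B_comp_measurable:
  assumes f: "f \<in> borel_measurable N" "g \<in> borel_measurable N" "h \<in> borel_measurable N"
    and nn: "\<And>z. 0 \<le> f z" "\<And>z. 0 \<le> g z" "\<And>z. 0 \<le> h z"
  shows "(\<lambda>z. B (f z) (g z) (h z)) \<in> borel_measurable N"
proof -
  have "(\<lambda>z. (f z, g z, h z)) \<in> measurable N (restrict_space borel ({0..} \<times> {0..} \<times> {0..}))"
    using f nn by (intro measurable_restrict_space2) auto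
  from measurable_compose[OF this B_measurable] show ?thesis by simp
qed

text \<open>The form as one integral over \<open>z = (y, x)\<close>, so that either variable can be
  integrated first.\<close>

definition I_lborel :: "(real ^ 'd \<Rightarrow> real) \<Rightarrow> (real ^ 'd \<Rightarrow> real) \<Rightarrow> (real ^ 'd \<Rightarrow> real) \<Rightarrow> ennreal" where
  "I_lborel f g h =
    (\<integral>\<^sup>+z. ennreal (B (f (fst z)) (g (snd z - fst z)) (h (snd z))) \<partial>(lborel \<Otimes>\<^sub>M lborel))"

text \<open>Borel measurability makes \<open>g (x - y)\<close> measurable on the product space, and
  the finite total is recorded as a real number.\<close>

definition mass_function :: "(real ^ 'd \<Rightarrow> real) \<Rightarrow> real \<Rightarrow> bool" where
  "mass_function f a \<longleftrightarrow> f \<in> borel_measurable borel \<and> (\<forall>x. 0 \<le> f x) \<and> 0 \<le> a \<and>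
    (\<integral>\<^sup>+x. ennreal (f x) \<partial>lborel) = ennreal a"

lemma mass_functionD:
  assumes "mass_function f a"
  shows "f \<in> borel_measurable borel" "0 \<le> f x" "0 \<le> a" "(\<integral>\<^sup>+x. ennreal (f x) \<partial>lborel) = ennreal a"
  using assms by (auto simp: mass_function_def)

lemma mass_function_integral:
  assumes "mass_function f a"
  shows "nonneg_integrable f" "integral\<^sup>L lebesgue f = a"
proof -
  note D = mass_functionD[OF assms]
  note [measurable] = D(1)
  have "integrable lborel f"
    using D by (intro integrableI_nn_integral_finite[of _ _ a]) auto
  then show "nonneg_integrable f"
    using D(2) by (simp add: nonneg_integrable_def integrable_completion)
  show "integral\<^sup>L lebesgue f = a"
    using D by (simp add: integral_completion integral_eq_nn_integral)
qed

lemma B_measurable_pair: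
  assumes "mass_function f a" "mass_function g b" "mass_function h c"
  shows "(\<lambda>z. B (f (fst z)) (g (snd z - fst z)) (h (snd z))) \<in> borel_measurable (lborel \<Otimes>\<^sub>M lborel)"
proof -
  note [measurable] = assms[THEN mass_functionD(1)]
  show ?thesis
    using assms[THEN mass_functionD(2)] by (intro B_comp_measurable) auto
qed

lemma I_form_eq_I_lborel:
  assumes "mass_function f a" "mass_function g b" "mass_function h c"
  shows "I_form B f g h = I_lborel f g h"
proof -
  note [measurable] = B_measurable_pair[OF assms]
  show ?thesis unfolding I_lborel_def I_form_eq
    by (subst lborel.nn_integral_fst[symmetric]) auto
qed

lemma I_lborel_le:
  assumes "mass_function f a" "mass_function g b" "mass_function h c"
  shows "I_lborel f g h \<le> ennreal (A * B a b c)"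
proof -
  have "admissible_constant dim B A" using A by (simp add: optimal_constant_def)
  then have le: "enn2ereal (I_lborel f g h) \<le> ereal (A * B a b c)"
    using assms[THEN mass_function_integral(1)] assms[THEN mass_function_integral(2)]
    unfolding admissible_constant_def I_form_eq_I_lborel[OF assms, symmetric] by blast
  have "e2ennreal (enn2ereal (I_lborel f g h)) \<le> e2ennreal (ereal (A * B a b c))"
    using le by (rule e2ennreal_mono)
  then show ?thesis by (simp add: e2ennreal_ereal)
qed

lemma mass_function_indicator_ball:
  "mass_function (indicator (ball 0 R) :: real ^ 'd \<Rightarrow> real) (measure lborel (ball 0 R :: (real ^ 'd) set))"
proof -
  have "emeasure lborel (ball 0 R :: (real ^ 'd) set) \<noteq> top"
    using emeasure_lborel_ball_finite[of "0 :: real ^ 'd" R] by simp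
  then show ?thesis
    by (simp add: mass_function_def emeasure_eq_ennreal_measure ennreal_indicator
        borel_measurable_indicator)
qed

text \<open>Tested on the unit ball, twice, and the ball of radius 2: if \<open>y\<close> and
  \<open>x - y\<close> lie in the unit ball, then \<open>x\<close> lies in the larger one and the
  integrand is \<open>B 1 1 1 > 0\<close>.\<close>

lemma A_pos: "0 < A"
proof (rule ccontr)
  assume "\<not> 0 < A"
  define f :: "real ^ 'd \<Rightarrow> real" where "f = indicator (ball 0 1)"
  define h :: "real ^ 'd \<Rightarrow> real" where "h = indicator (ball 0 2)"
  define v where "v = measure lborel (ball 0 1 :: (real ^ 'd) set)"
  define w where "w = measure lborel (ball 0 2 :: (real ^ 'd) set)"
  have v: "0 < v" unfolding v_def by (intro content_ball_pos) simp
  have f: "mass_function f v" and h: "mass_function h w"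
    by (simp_all add: f_def h_def v_def w_def mass_function_indicator_ball)
  note [measurable] = f[THEN mass_functionD(1)]
  have "0 < ennreal (B 1 1 1) * (ennreal v * ennreal v)"
    using v B_pos[of 1 1 1] by (simp add: ennreal_zero_less_mult_iff)
  also have "\<dots> = ennreal (B 1 1 1) *
      (\<integral>\<^sup>+z. ennreal (f (fst z)) * ennreal (f (snd z - fst z)) \<partial>(lborel \<Otimes>\<^sub>M lborel))"
    by (subst nn_integral_lborel_pair(2)) (simp_all add: f[THEN mass_functionD(4)])
  also have "\<dots> = (\<integral>\<^sup>+z. ennreal (B 1 1 1) * (ennreal (f (fst z)) * ennreal (f (snd z - fst z)))
      \<partial>(lborel \<Otimes>\<^sub>M lborel))"
    by (rule nn_integral_cmult[symmetric]) simp
  also have "\<dots> \<le> I_lborel f f h"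
    unfolding I_lborel_def
  proof (intro nn_integral_mono)
    fix z :: "(real ^ 'd) \<times> (real ^ 'd)"
    have "norm (snd z) < 2" if "norm (fst z) < 1" "norm (snd z - fst z) < 1"
      using norm_triangle_ineq[of "fst z" "snd z - fst z"] that by simp
    then show "ennreal (B 1 1 1) * (ennreal (f (fst z)) * ennreal (f (snd z - fst z)))
      \<le> ennreal (B (f (fst z)) (f (snd z - fst z)) (h (snd z)))"
      by (auto simp: f_def h_def indicator_def)
  qed
  also have "\<dots> \<le> ennreal (A * B v v w)" using f h by (intro I_lborel_le)
  also have "\<dots> = 0"
    using \<open>\<not> 0 < A\<close> B_nonneg[of v v w] f h[THEN mass_functionD(3)] v
    by (simp add: ennreal_eq_0_iff mult_nonpos_nonneg)
  finally show False by simp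
qed

lemma nn_integral_pairs:
  assumes "mass_function f a" "mass_function g b" "mass_function h c"
    and k: "0 \<le> k"
  shows "(\<integral>\<^sup>+z. ennreal (k * (f (fst z) * g (snd z - fst z) + g (snd z - fst z) * h (snd z)
      + f (fst z) * h (snd z))) \<partial>(lborel \<Otimes>\<^sub>M lborel)) = ennreal (k * (a * b + b * c + a * c))"
proof -
  note [measurable] = assms(1-3)[THEN mass_functionD(1)]
  note nn = assms(1-3)[THEN mass_functionD(2)] assms(1-3)[THEN mass_functionD(3)]
  note eq = assms(1-3)[THEN mass_functionD(4)]
  have "(\<integral>\<^sup>+z. ennreal (k * (f (fst z) * g (snd z - fst z) + g (snd z - fst z) * h (snd z)
        + f (fst z) * h (snd z))) \<partial>(lborel \<Otimes>\<^sub>M lborel)) =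
      (\<integral>\<^sup>+z. ennreal k * (ennreal (f (fst z)) * ennreal (g (snd z - fst z))
        + ennreal (g (snd z - fst z)) * ennreal (h (snd z))
        + ennreal (f (fst z)) * ennreal (h (snd z))) \<partial>(lborel \<Otimes>\<^sub>M lborel))"
    using nn k by (simp add: ennreal_mult' ennreal_plus)
  also have "\<dots> = ennreal k * ((\<integral>\<^sup>+z. ennreal (f (fst z)) * ennreal (g (snd z - fst z)) \<partial>(lborel \<Otimes>\<^sub>M lborel))
      + (\<integral>\<^sup>+z. ennreal (g (snd z - fst z)) * ennreal (h (snd z)) \<partial>(lborel \<Otimes>\<^sub>M lborel))
      + (\<integral>\<^sup>+z. ennreal (f (fst z)) * ennreal (h (snd z)) \<partial>(lborel \<Otimes>\<^sub>M lborel)))"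
    by (subst nn_integral_cmult, simp, subst nn_integral_add, simp, simp, subst nn_integral_add) simp_all
  also have "\<dots> = ennreal k * (ennreal a * ennreal b + ennreal b * ennreal c + ennreal a * ennreal c)"
    by (subst nn_integral_lborel_pair(1), simp, simp,
        subst nn_integral_lborel_pair(2), simp, simp, subst nn_integral_lborel_pair(3)) (simp_all add: eq)
  also have "\<dots> = ennreal (k * (a * b + b * c + a * c))"
    using nn k by (simp add: ennreal_mult' ennreal_plus)
  finally show ?thesis .
qed

text \<open>Triples of values at level distance above \<open>M\<close> contribute at most
  \<open>K / M\<close> times the pairs. At distance at most \<open>M\<close> the values are
  comparable and one of their levels is light, so the contribution is controlled by a product of a
  light part with one other function.\<close>

lemma I_lborel_le_if_light:
  fixes M :: nat and c\<^sub>0 :: real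
  assumes fgh: "mass_function f a" "mass_function g b" "mass_function h c"
    and M: "0 < M" and c: "0 \<le> c\<^sub>0"
    and light: "\<And>k k' k''. \<bar>k - k'\<bar> + \<bar>k - k''\<bar> \<le> int M \<Longrightarrow>
      dyadic_mass f k < ennreal c\<^sub>0 \<or> dyadic_mass g k' < ennreal c\<^sub>0 \<or> dyadic_mass h k'' < ennreal c\<^sub>0"
  shows "I_lborel f g h \<le> ennreal (K / M * (a * b + b * c + a * c) +
    K * 3 * 2 ^ (M + 1) * (2 * (2 * real M + 1) * c\<^sub>0 * (2 * a + c)))"
proof -
  note [measurable] = fgh[THEN mass_functionD(1)]
  note nn = fgh[THEN mass_functionD(2)] and nn' = fgh[THEN mass_functionD(3)]
  note eq = fgh[THEN mass_functionD(4)]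
  define D where "D = K * 3 * 2 ^ (M + 1)"
  define E where "E = 2 * (2 * real M + 1) * c\<^sub>0"
  have D: "0 \<le> D" and E: "0 \<le> E" using K_pos c by (simp_all add: D_def E_def)
  \<comment> \<open>The index tells which function is light; \<open>L1\<close> and \<open>L3\<close>
    pair \<open>f\<close> with \<open>h\<close>, \<open>L2\<close> pairs \<open>f\<close> with
    \<open>g\<close>.\<close>
  define L1 where "L1 z = light f c\<^sub>0 M (lev (h (snd z))) (fst z) * ennreal (h (snd z))" for z
  define L2 where "L2 z = ennreal (f (fst z)) * light g c\<^sub>0 M (lev (f (fst z))) (snd z - fst z)" for z
  define L3 where "L3 z = ennreal (f (fst z)) * light h c\<^sub>0 M (lev (f (fst z))) (snd z)" for z
  have light_pair [measurable]:
      "(\<lambda>z. light f c\<^sub>0 M (lev (h (snd z))) (fst z)) \<in> borel_measurable (lborel \<Otimes>\<^sub>M lborel)"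
      "(\<lambda>z. light g c\<^sub>0 M (lev (f (fst z))) (snd z - fst z)) \<in> borel_measurable (lborel \<Otimes>\<^sub>M lborel)"
      "(\<lambda>z. light h c\<^sub>0 M (lev (f (fst z))) (snd z)) \<in> borel_measurable (lborel \<Otimes>\<^sub>M lborel)"
    by (rule light_measurable; measurable)+
  have light_single [measurable]:
      "light f c\<^sub>0 M l \<in> borel_measurable borel" "light g c\<^sub>0 M l \<in> borel_measurable borel"
      "light h c\<^sub>0 M l \<in> borel_measurable borel" for l
    by (rule light_measurable; simp)+
  have L_measurable [measurable]: "L1 \<in> borel_measurable (lborel \<Otimes>\<^sub>M lborel)"
      "L2 \<in> borel_measurable (lborel \<Otimes>\<^sub>M lborel)" "L3 \<in> borel_measurable (lborel \<Otimes>\<^sub>M lborel)"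
    unfolding L1_def L2_def L3_def by measurable
  have bound: "(\<integral>\<^sup>+x. light f' c\<^sub>0 M l x \<partial>lborel) \<le> ennreal E"
    if "f' \<in> borel_measurable borel" for f' :: "real ^ 'd \<Rightarrow> real" and l
    unfolding E_def using that by (rule nn_integral_light_le)
  \<comment> \<open>Here \<open>y\<close> is integrated first: with \<open>x\<close> fixed, the
    centre \<open>lev (h x)\<close> is a constant. In \<open>L2\<close> and \<open>L3\<close> the
    centre depends on \<open>y\<close>, and \<open>x\<close> is integrated first.\<close>
  have L1: "(\<integral>\<^sup>+z. L1 z \<partial>(lborel \<Otimes>\<^sub>M lborel)) \<le> ennreal (E * c)"
  proof -
    have "(\<integral>\<^sup>+z. L1 z \<partial>(lborel \<Otimes>\<^sub>M lborel)) = (\<integral>\<^sup>+x. (\<integral>\<^sup>+y. L1 (y, x) \<partial>lborel) \<partial>lborel)"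
      by (rule lborel_pair.nn_integral_snd[symmetric]) simp
    also have "\<dots> = (\<integral>\<^sup>+x. (\<integral>\<^sup>+y. light f c\<^sub>0 M (lev (h x)) y \<partial>lborel) * ennreal (h x) \<partial>lborel)"
      by (simp add: L1_def nn_integral_multc)
    also have "\<dots> \<le> (\<integral>\<^sup>+x. ennreal E * ennreal (h x) \<partial>lborel)"
      by (intro nn_integral_mono mult_right_mono bound) auto
    also have "\<dots> = ennreal (E * c)" using E by (simp add: nn_integral_cmult eq ennreal_mult')
    finally show ?thesis .
  qed
  have L2: "(\<integral>\<^sup>+z. L2 z \<partial>(lborel \<Otimes>\<^sub>M lborel)) \<le> ennreal (E * a)"
  proof -
    have "(\<integral>\<^sup>+z. L2 z \<partial>(lborel \<Otimes>\<^sub>M lborel)) = (\<integral>\<^sup>+y. (\<integral>\<^sup>+x. L2 (y, x) \<partial>lborel) \<partial>lborel)"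
      by (rule lborel.nn_integral_fst[symmetric]) simp
    also have "\<dots> = (\<integral>\<^sup>+y. ennreal (f y) * (\<integral>\<^sup>+x. light g c\<^sub>0 M (lev (f y)) x \<partial>lborel) \<partial>lborel)"
      by (simp add: L2_def nn_integral_cmult nn_integral_lborel_translate)
    also have "\<dots> \<le> (\<integral>\<^sup>+y. ennreal (f y) * ennreal E \<partial>lborel)"
      by (intro nn_integral_mono mult_left_mono bound) auto
    also have "\<dots> = ennreal (E * a)" using E by (subst nn_integral_multc) (simp_all add: eq ennreal_mult' mult.commute)
    finally show ?thesis .
  qed
  have L3: "(\<integral>\<^sup>+z. L3 z \<partial>(lborel \<Otimes>\<^sub>M lborel)) \<le> ennreal (E * a)"
  proof -
    have "(\<integral>\<^sup>+z. L3 z \<partial>(lborel \<Otimes>\<^sub>M lborel)) = (\<integral>\<^sup>+y. (\<integral>\<^sup>+x. L3 (y, x) \<partial>lborel) \<partial>lborel)"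
      by (rule lborel.nn_integral_fst[symmetric]) simp
    also have "\<dots> = (\<integral>\<^sup>+y. ennreal (f y) * (\<integral>\<^sup>+x. light h c\<^sub>0 M (lev (f y)) x \<partial>lborel) \<partial>lborel)"
      by (simp add: L3_def nn_integral_cmult)
    also have "\<dots> \<le> (\<integral>\<^sup>+y. ennreal (f y) * ennreal E \<partial>lborel)"
      by (intro nn_integral_mono mult_left_mono bound) auto
    also have "\<dots> = ennreal (E * a)" using E by (subst nn_integral_multc) (simp_all add: eq ennreal_mult' mult.commute)
    finally show ?thesis .
  qed
  have pointwise: "ennreal (B (f (fst z)) (g (snd z - fst z)) (h (snd z))) \<le>
    ennreal (K / M * (f (fst z) * g (snd z - fst z) + g (snd z - fst z) * h (snd z) + f (fst z) * h (snd z)))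
    + ennreal D * (L1 z + L2 z + L3 z)" (is "_ \<le> ennreal (K / M * ?Q) + _") for z
  proof -
    define x where "x = f (fst z)"
    define y where "y = g (snd z - fst z)"
    define w where "w = h (snd z)"
    have nn: "0 \<le> x" "0 \<le> y" "0 \<le> w" using nn by (auto simp: x_def y_def w_def)
    define d where "d = \<bar>lev x - lev y\<bar> + \<bar>lev x - lev w\<bar>"
    consider "\<not> (0 < x \<and> 0 < y \<and> 0 < w)" | "0 < x" "0 < y" "0 < w" "int M < d"
      | "0 < x" "0 < y" "0 < w" "d \<le> int M" by linarith
    then show ?thesis
    proof cases
      case 1
      then have "B x y w = 0" using nn by (intro B_zero) auto
      then show ?thesis by (simp add: x_def y_def w_def)
    next
      \<comment> \<open>Far levels: the distance exceeds \<open>M\<close>, which gains the factor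
        \<open>1 / M\<close>.\<close>
      case 2
      have "B x y w * M \<le> B x y w * d"
        using 2 nn by (intro mult_left_mono B_nonneg) auto
      also have "\<dots> \<le> K * (x * y + y * w + x * w)"
        unfolding d_def using B_lev_diff_le[of x y w] 2 by simp
      finally have "B x y w \<le> K / M * (x * y + y * w + x * w)"
        using M by (simp add: field_simps)
      then have "ennreal (B x y w) \<le> ennreal (K / M * (x * y + y * w + x * w))" by (rule ennreal_leI)
      then show ?thesis by (simp add: x_def y_def w_def add_increasing2)
    next
      \<comment> \<open>Near levels: each of the three pair products is at most
        \<open>2 ^ (M + 1)\<close> times \<open>x * w\<close>, and likewise times
        \<open>x * y\<close>, so one product that contains the light value is enough.\<close>
      case 3
      then have "lev y \<le> lev x + int M" "lev y \<le> lev w + int M" "lev w \<le> lev x + int M"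
          "lev w \<le> lev y + int M"
        by (auto simp: d_def)
      with 3 have cmp: "y \<le> 2 ^ (M + 1) * x" "y \<le> 2 ^ (M + 1) * w" "w \<le> 2 ^ (M + 1) * x"
          "w \<le> 2 ^ (M + 1) * y"
        by (simp_all only: lev_le_lev)
      have one: "1 \<le> (2::real) ^ (M + 1)" by (rule one_le_power) simp
      have Dw: "B x y w \<le> D * (x * w)"
      proof -
        have "x * y \<le> 2 ^ (M + 1) * (x * w)" "y * w \<le> 2 ^ (M + 1) * (x * w)" "x * w \<le> 2 ^ (M + 1) * (x * w)"
          using mult_left_mono[OF cmp(2), of x] mult_right_mono[OF cmp(1), of w]
            mult_right_mono[OF one, of "x * w"] nn by (simp_all add: mult_ac)
        then have "K * (x * y + y * w + x * w) \<le> K * (3 * 2 ^ (M + 1) * (x * w))"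
          using K_pos by (intro mult_left_mono) auto
        then show ?thesis using B_le_pairs[OF nn] by (simp add: D_def mult_ac)
      qed
      have Dy: "B x y w \<le> D * (x * y)"
      proof -
        have "x * w \<le> 2 ^ (M + 1) * (x * y)" "y * w \<le> 2 ^ (M + 1) * (x * y)" "x * y \<le> 2 ^ (M + 1) * (x * y)"
          using mult_left_mono[OF cmp(4), of x] mult_left_mono[OF cmp(3), of y]
            mult_right_mono[OF one, of "x * y"] nn by (simp_all add: mult_ac)
        then have "K * (x * y + y * w + x * w) \<le> K * (3 * 2 ^ (M + 1) * (x * y))"
          using K_pos by (intro mult_left_mono) auto
        then show ?thesis using B_le_pairs[OF nn] by (simp add: D_def mult_ac)
      qed
      note pos = 3(1-3)
      have near: "\<bar>lev x - lev w\<bar> \<le> int M" "\<bar>lev w - lev x\<bar> \<le> int M" "\<bar>lev y - lev x\<bar> \<le> int M"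
        using 3(4) by (auto simp: d_def)
      from light[of "lev x" "lev y" "lev w"] 3(4)
      consider "dyadic_mass f (lev x) < ennreal c\<^sub>0" | "dyadic_mass g (lev y) < ennreal c\<^sub>0"
        | "dyadic_mass h (lev w) < ennreal c\<^sub>0" by (auto simp: d_def)
      then have "ennreal (B x y w) \<le> ennreal D * (L1 z + L2 z + L3 z)"
      proof cases
        case 1
        then have "L1 z = ennreal (x * w)"
          using near pos by (simp add: L1_def light_def x_def w_def ennreal_mult')
        then have "ennreal (D * (x * w)) \<le> ennreal D * (L1 z + L2 z + L3 z)"
          using D by (simp add: ennreal_mult' distrib_left add.assoc)
        with ennreal_leI[OF Dw] show ?thesis by (rule order_trans)
      next
        case 2
        then have "L2 z = ennreal (x * y)"
          using near pos by (simp add: L2_def light_def x_def y_def ennreal_mult')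
        then have "ennreal (D * (x * y)) \<le> ennreal D * (L1 z + L2 z + L3 z)"
          using D by (simp add: ennreal_mult' distrib_left add_increasing add_increasing2)
        with ennreal_leI[OF Dy] show ?thesis by (rule order_trans)
      next
        case 3
        then have "L3 z = ennreal (x * w)"
          using near pos by (simp add: L3_def light_def x_def w_def ennreal_mult')
        then have "ennreal (D * (x * w)) \<le> ennreal D * (L1 z + L2 z + L3 z)"
          using D by (simp add: ennreal_mult' distrib_left add_increasing)
        with ennreal_leI[OF Dw] show ?thesis by (rule order_trans)
      qed
      then show ?thesis by (simp add: x_def y_def w_def add_increasing)
    qed
  qed
  have "I_lborel f g h \<le> (\<integral>\<^sup>+z. ennreal (K / M * (f (fst z) * g (snd z - fst z)
      + g (snd z - fst z) * h (snd z) + f (fst z) * h (snd z))) + ennreal D * (L1 z + L2 z + L3 z)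
      \<partial>(lborel \<Otimes>\<^sub>M lborel))"
    unfolding I_lborel_def by (intro nn_integral_mono pointwise)
  also have "\<dots> = ennreal (K / M * (a * b + b * c + a * c)) + ennreal D *
      ((\<integral>\<^sup>+z. L1 z \<partial>(lborel \<Otimes>\<^sub>M lborel)) + (\<integral>\<^sup>+z. L2 z \<partial>(lborel \<Otimes>\<^sub>M lborel))
        + (\<integral>\<^sup>+z. L3 z \<partial>(lborel \<Otimes>\<^sub>M lborel)))"
    using K_pos by (subst nn_integral_add, simp, simp, subst nn_integral_pairs[OF fgh], simp,
        subst nn_integral_cmult, simp, subst nn_integral_add, simp, simp, subst nn_integral_add) simp_all
  also have "\<dots> \<le> ennreal (K / M * (a * b + b * c + a * c)) + ennreal D *
      (ennreal (E * c) + ennreal (E * a) + ennreal (E * a))"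
    using L1 L2 L3 by (intro add_left_mono mult_left_mono add_mono) auto
  also have "\<dots> = ennreal (K / M * (a * b + b * c + a * c) + D * (E * c + E * a + E * a))"
    using K_pos D E nn' by (simp flip: ennreal_plus ennreal_mult')
  also have "D * (E * c + E * a + E * a) =
      K * 3 * 2 ^ (M + 1) * (2 * (2 * real M + 1) * c\<^sub>0 * (2 * a + c))"
    unfolding D_def[symmetric] E_def[symmetric] by (simp add: algebra_simps)
  finally show ?thesis .
qed

end

subsection \<open>Cutting along a level radius\<close>

text \<open>The cut acts on values, not on points, so one centre and one radius serve all three
  functions. The inequality is strict, so nothing is inner for \<open>R = 0\<close>.\<close>

definition inner :: "int \<Rightarrow> nat \<Rightarrow> real \<Rightarrow> real" where
  "inner k R v = (if 0 < v \<and> \<bar>lev v - k\<bar> < int R then v else 0)"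

lemma inner_measurable [measurable]: "inner k R \<in> borel_measurable borel"
proof -
  have [measurable]: "(\<lambda>v. real_of_int (lev v)) \<in> borel_measurable borel"
    by (rule measurable_compose[where g = real_of_int and N = "count_space UNIV"]; simp)
  have "(\<bar>i - j\<bar> < int R) = (\<bar>real_of_int i - real_of_int j\<bar> < real R)" for i j
    by linarith
  then show ?thesis unfolding inner_def[abs_def] by simp
qed

lemma inner_bounds: "0 \<le> v \<Longrightarrow> 0 \<le> inner k R v" "0 \<le> v \<Longrightarrow> inner k R v \<le> v"
  by (auto simp: inner_def)

text \<open>A radius separates \<open>a\<close> from \<open>b\<close> only if it lies above the
  smaller and not above the larger of the two absolute values.\<close>

lemma card_separating_radii:
  fixes a b :: int
  assumes "finite S"
  shows "card {R \<in> S. (\<bar>a\<bar> < int R) \<noteq> (\<bar>b\<bar> < int R)} \<le> nat \<bar>a - b\<bar>"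
proof -
  have "{R \<in> S. (\<bar>a\<bar> < int R) \<noteq> (\<bar>b\<bar> < int R)} \<subseteq> {nat (min \<bar>a\<bar> \<bar>b\<bar>)<..nat (max \<bar>a\<bar> \<bar>b\<bar>)}"
    by auto
  then have "card {R \<in> S. (\<bar>a\<bar> < int R) \<noteq> (\<bar>b\<bar> < int R)} \<le> card {nat (min \<bar>a\<bar> \<bar>b\<bar>)<..nat (max \<bar>a\<bar> \<bar>b\<bar>)}"
    by (intro card_mono) auto
  also have "\<dots> = nat (max \<bar>a\<bar> \<bar>b\<bar>) - nat (min \<bar>a\<bar> \<bar>b\<bar>)" by simp
  also have "\<dots> = nat (max \<bar>a\<bar> \<bar>b\<bar> - min \<bar>a\<bar> \<bar>b\<bar>)"
    by (simp add: nat_diff_distrib)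
  also have "\<dots> \<le> nat \<bar>a - b\<bar>"
    using abs_triangle_ineq2[of a b] abs_triangle_ineq2[of b a]
    by (intro nat_mono) (simp add: max_def min_def abs_minus_commute)
  finally show ?thesis .
qed

context convolution_form
begin

text \<open>For a function of finite mass the integral is finite, so \<open>enn2real\<close> loses
  nothing.\<close>

definition inner_mass :: "int \<Rightarrow> nat \<Rightarrow> (real ^ 'd \<Rightarrow> real) \<Rightarrow> real" where
  "inner_mass k R f = enn2real (\<integral>\<^sup>+x. ennreal (inner k R (f x)) \<partial>lborel)"

lemma mass_function_inner:
  assumes f: "mass_function f a"
  shows "mass_function (\<lambda>x. inner k R (f x)) (inner_mass k R f)"
    and "mass_function (\<lambda>x. f x - inner k R (f x)) (a - inner_mass k R f)"
    and "0 \<le> inner_mass k R f" "inner_mass k R f \<le> a"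
proof -
  note D = mass_functionD[OF f]
  note [measurable] = D(1)
  have le: "(\<integral>\<^sup>+x. ennreal (inner k R (f x)) \<partial>lborel) \<le> ennreal a"
    unfolding D(4)[symmetric] using inner_bounds D by (intro nn_integral_mono ennreal_leI) auto
  then have fin: "(\<integral>\<^sup>+x. ennreal (inner k R (f x)) \<partial>lborel) = ennreal (inner_mass k R f)"
    unfolding inner_mass_def by (metis ennreal_enn2real ennreal_less_top order_le_less_trans)
  show m0: "0 \<le> inner_mass k R f" by (simp add: inner_mass_def)
  show ma: "inner_mass k R f \<le> a" using le D(3) by (simp add: fin)
  show "mass_function (\<lambda>x. inner k R (f x)) (inner_mass k R f)"
    using fin m0 inner_bounds D by (simp add: mass_function_def)
  have "ennreal (inner_mass k R f) + (\<integral>\<^sup>+x. ennreal (f x - inner k R (f x)) \<partial>lborel) =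
      (\<integral>\<^sup>+x. ennreal (inner k R (f x)) + ennreal (f x - inner k R (f x)) \<partial>lborel)"
    unfolding fin[symmetric] by (rule nn_integral_add[symmetric]) simp_all
  also have "\<dots> = (\<integral>\<^sup>+x. ennreal (f x) \<partial>lborel)"
    using inner_bounds D by (intro nn_integral_cong) (simp flip: ennreal_plus)
  also have "\<dots> = ennreal (inner_mass k R f) + ennreal (a - inner_mass k R f)"
    using D m0 ma by (simp flip: ennreal_plus)
  finally have "(\<integral>\<^sup>+x. ennreal (f x - inner k R (f x)) \<partial>lborel) = ennreal (a - inner_mass k R f)"
    by (simp add: ennreal_add_left_cancel)
  then show "mass_function (\<lambda>x. f x - inner k R (f x)) (a - inner_mass k R f)"
    using inner_bounds D ma by (simp add: mass_function_def)
qed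

lemma dyadic_mass_le_inner_mass:
  assumes f: "mass_function f a" and j: "\<bar>j - k\<bar> < int R"
  shows "dyadic_mass f j \<le> ennreal (inner_mass k R f)"
proof -
  note D = mass_functionD[OF f]
  have "dyadic_mass f j \<le> (\<integral>\<^sup>+x. ennreal (f x) * indicator (dyadic_level f j) x \<partial>lborel)"
    by (rule dyadic_mass_le[OF D(1)])
  also have "\<dots> \<le> (\<integral>\<^sup>+x. ennreal (inner k R (f x)) \<partial>lborel)"
    using j by (intro nn_integral_mono) (auto simp: indicator_def mem_dyadic_level_iff inner_def)
  also have "\<dots> = ennreal (inner_mass k R f)"
    by (rule mass_functionD(4)[OF mass_function_inner(1)[OF f]])
  finally show ?thesis .
qed

lemma infsum_dyadic_mass_le_outer_mass:
  assumes f: "mass_function f a" and S: "\<And>j. j \<in> S \<Longrightarrow> int R \<le> \<bar>j - k\<bar>"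
  shows "(\<Sum>\<^sub>\<infinity>j\<in>S. dyadic_mass f j) \<le> ennreal (a - inner_mass k R f)"
proof -
  note D = mass_functionD[OF f]
  have "(\<Sum>\<^sub>\<infinity>j\<in>S. dyadic_mass f j)
      \<le> (\<integral>\<^sup>+x. (if 0 < f x \<and> lev (f x) \<in> S then ennreal (f x) else 0) \<partial>lborel)"
    by (rule infsum_dyadic_mass_le[OF D(1)])
  also have "\<dots> \<le> (\<integral>\<^sup>+x. ennreal (f x - inner k R (f x)) \<partial>lborel)"
    using S by (intro nn_integral_mono) (fastforce simp: inner_def)
  also have "\<dots> = ennreal (a - inner_mass k R f)"
    by (rule mass_functionD(4)[OF mass_function_inner(2)[OF f]])
  finally show ?thesis .
qed

lemma infsum_dyadic_mass_le_mass:
  assumes f: "mass_function f a"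
  shows "(\<Sum>\<^sub>\<infinity>j\<in>S. dyadic_mass f j) \<le> ennreal a"
proof -
  \<comment> \<open>With radius 0 every level is an outer level.\<close>
  have "(\<Sum>\<^sub>\<infinity>j\<in>S. dyadic_mass f j) \<le> ennreal (a - inner_mass 0 0 f)"
    using f by (rule infsum_dyadic_mass_le_outer_mass) simp
  also have "\<dots> \<le> ennreal a" using mass_function_inner(3)[OF f] by (intro ennreal_leI) simp
  finally show ?thesis .
qed

text \<open>A radius that separates no two of the three levels leaves \<open>B x y w\<close> intact
  as the inner or the outer term. The other radii lose at most \<open>B x y w\<close> each, and
  their number is bounded by the level distance, which \<open>B_lev_diff_le\<close> pays
  for.\<close>

lemma sum_B_cut_ge:
  assumes S: "finite S" and xyw: "0 \<le> x" "0 \<le> y" "0 \<le> w"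
  shows "real (card S) * B x y w \<le>
    (\<Sum>R\<in>S. B (inner k R x) (inner k R y) (inner k R w)
      + B (x - inner k R x) (y - inner k R y) (w - inner k R w))
    + K * (x * y + y * w + x * w)"
proof (cases "0 < x \<and> 0 < y \<and> 0 < w")
  case True
  let ?cut = "\<lambda>R. B (inner k R x) (inner k R y) (inner k R w)
      + B (x - inner k R x) (y - inner k R y) (w - inner k R w)"
  define b where "b = B x y w"
  have b: "0 \<le> b" using xyw by (simp add: b_def B_nonneg)
  define T1 where "T1 = {R \<in> S. (\<bar>lev x - k\<bar> < int R) \<noteq> (\<bar>lev y - k\<bar> < int R)}"
  define T2 where "T2 = {R \<in> S. (\<bar>lev x - k\<bar> < int R) \<noteq> (\<bar>lev w - k\<bar> < int R)}"
  have T: "finite T1" "finite T2" using S by (auto simp: T1_def T2_def)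
  have card: "card T1 \<le> nat \<bar>lev x - lev y\<bar>" "card T2 \<le> nat \<bar>lev x - lev w\<bar>"
    using card_separating_radii[OF S, of "lev x - k" "lev y - k"]
      card_separating_radii[OF S, of "lev x - k" "lev w - k"] by (simp_all add: T1_def T2_def)
  have nn: "0 \<le> ?cut R" for R
    using xyw inner_bounds by (intro add_nonneg_nonneg B_nonneg) auto
  have "b \<le> ?cut R + (if R \<in> T1 then b else 0) + (if R \<in> T2 then b else 0)" if "R \<in> S" for R
  proof (cases "R \<in> T1 \<or> R \<in> T2")
    case True
    then show ?thesis using nn[of R] b by auto
  next
    case False
    then have same: "(\<bar>lev x - k\<bar> < int R) = (\<bar>lev y - k\<bar> < int R)"
        "(\<bar>lev x - k\<bar> < int R) = (\<bar>lev w - k\<bar> < int R)"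
      using that by (auto simp: T1_def T2_def)
    \<comment> \<open>Either all three values are inner or all are outer; the other term is
      \<open>B 0 0 0 = 0\<close>.\<close>
    have "?cut R = b"
      using True same by (cases "\<bar>lev x - k\<bar> < int R") (simp_all add: inner_def b_def B_zero)
    then show ?thesis using b by simp
  qed
  then have "(\<Sum>R\<in>S. b) \<le> (\<Sum>R\<in>S. ?cut R + (if R \<in> T1 then b else 0) + (if R \<in> T2 then b else 0))"
    by (rule sum_mono)
  also have "\<dots> = (\<Sum>R\<in>S. ?cut R) + (\<Sum>R\<in>S. if R \<in> T1 then b else 0) + (\<Sum>R\<in>S. if R \<in> T2 then b else 0)"
    by (simp add: sum.distrib)
  also have "(\<Sum>R\<in>S. if R \<in> T1 then b else 0) = card T1 * b"
    using S by (simp add: T1_def flip: sum.inter_filter)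
  also have "(\<Sum>R\<in>S. if R \<in> T2 then b else 0) = card T2 * b"
    using S by (simp add: T2_def flip: sum.inter_filter)
  finally have "card S * b \<le> (\<Sum>R\<in>S. ?cut R) + b * (real (card T1) + real (card T2))"
    by (simp add: algebra_simps)
  also have "\<dots> \<le> (\<Sum>R\<in>S. ?cut R) + b * (\<bar>lev x - lev y\<bar> + \<bar>lev x - lev w\<bar>)"
  proof (intro add_left_mono mult_left_mono b)
    show "real (card T1) + real (card T2) \<le> \<bar>lev x - lev y\<bar> + \<bar>lev x - lev w\<bar>"
      using card by linarith
  qed
  also have "\<dots> \<le> (\<Sum>R\<in>S. ?cut R) + K * (x * y + y * w + x * w)"
    using B_lev_diff_le[of x y w] True by (simp add: b_def)
  finally show ?thesis by (simp add: b_def)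
next
  case False
  then have "B x y w = 0" using xyw by (intro B_zero) auto
  moreover have "0 \<le> (\<Sum>R\<in>S. B (inner k R x) (inner k R y) (inner k R w)
      + B (x - inner k R x) (y - inner k R y) (w - inner k R w))"
    using xyw inner_bounds by (intro sum_nonneg add_nonneg_nonneg B_nonneg) auto
  ultimately show ?thesis using xyw K_pos by simp
qed

text \<open>An averaging argument: the cross terms of all radii in \<open>S\<close> together cost at
  most \<open>K * (a * b + b * c + a * c)\<close>, so they cannot exceed the average share for every
  radius.\<close>

lemma I_lborel_cut:
  assumes fgh: "mass_function f a" "mass_function g b" "mass_function h c"
    and S: "finite S" "S \<noteq> {}"
  shows "\<exists>R\<in>S. I_lborel f g h \<le> ennreal (A * (B (inner_mass k R f) (inner_mass k R g) (inner_mass k R h)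
      + B (a - inner_mass k R f) (b - inner_mass k R g) (c - inner_mass k R h))
      + K * (a * b + b * c + a * c) / card S)"
proof (rule ccontr)
  define X where "X R = A * (B (inner_mass k R f) (inner_mass k R g) (inner_mass k R h)
      + B (a - inner_mass k R f) (b - inner_mass k R g) (c - inner_mass k R h))" for R
  define T where "T = a * b + b * c + a * c"
  note nn = fgh[THEN mass_functionD(2)] and nn' = fgh[THEN mass_functionD(3)]
  have T: "0 \<le> T" using nn' by (simp add: T_def)
  have Bnn: "0 \<le> B (inner_mass k R f) (inner_mass k R g) (inner_mass k R h)"
      "0 \<le> B (a - inner_mass k R f) (b - inner_mass k R g) (c - inner_mass k R h)" for R
    using fgh[THEN mass_function_inner(3)] fgh[THEN mass_function_inner(4)]
    by (intro B_nonneg; simp)+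
  have X: "0 \<le> X R" for R unfolding X_def using A_pos Bnn by (intro mult_nonneg_nonneg add_nonneg_nonneg) auto
  define n where "n = card S"
  have n: "0 < n" using S by (simp add: n_def card_gt_0_iff)
  assume "\<not> ?thesis"
  then have less: "ennreal (X R + K * T / n) < I_lborel f g h" if "R \<in> S" for R
    using that unfolding X_def T_def n_def by (meson not_le)
  \<comment> \<open>The form is finite, so the rest can be argued with real numbers.\<close>
  obtain J where J: "I_lborel f g h = ennreal J" "0 \<le> J"
    using I_lborel_le[OF fgh] by (metis ennreal_cases ennreal_neq_top neq_top_trans)
  have XJ: "X R + K * T / n < J" if "R \<in> S" for R
  proof -
    have "0 \<le> X R + K * T / n" using X T K_pos by simp
    then show ?thesis using less[OF that] by (simp add: J ennreal_less_iff)
  qed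
  note m_in = fgh[THEN mass_function_inner(1)] and m_out = fgh[THEN mass_function_inner(2)]
  note [measurable] = B_measurable_pair[OF fgh] B_measurable_pair[OF m_in] B_measurable_pair[OF m_out]
    fgh[THEN mass_functionD(1)]
  have "ennreal (n * J) = of_nat n * I_lborel f g h"
    by (simp add: J ennreal_mult' ennreal_of_nat_eq_real_of_nat)
  also have "\<dots> = (\<integral>\<^sup>+z. of_nat n * ennreal (B (f (fst z)) (g (snd z - fst z)) (h (snd z))) \<partial>(lborel \<Otimes>\<^sub>M lborel))"
    unfolding I_lborel_def by (rule nn_integral_cmult[symmetric]) simp
  also have "\<dots> \<le> (\<integral>\<^sup>+z. (\<Sum>R\<in>S.
        ennreal (B (inner k R (f (fst z))) (inner k R (g (snd z - fst z))) (inner k R (h (snd z)))) +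
        ennreal (B (f (fst z) - inner k R (f (fst z))) (g (snd z - fst z) - inner k R (g (snd z - fst z)))
          (h (snd z) - inner k R (h (snd z))))) +
      ennreal (K * (f (fst z) * g (snd z - fst z) + g (snd z - fst z) * h (snd z) + f (fst z) * h (snd z)))
      \<partial>(lborel \<Otimes>\<^sub>M lborel))"
  proof (intro nn_integral_mono)
    fix z :: "(real ^ 'd) \<times> (real ^ 'd)"
    define x where "x = f (fst z)"
    define y where "y = g (snd z - fst z)"
    define w where "w = h (snd z)"
    have xyw: "0 \<le> x" "0 \<le> y" "0 \<le> w" using nn by (auto simp: x_def y_def w_def)
    have in_nn: "0 \<le> B (inner k R x) (inner k R y) (inner k R w)" for R
      using xyw inner_bounds by (intro B_nonneg) auto
    have out_nn: "0 \<le> B (x - inner k R x) (y - inner k R y) (w - inner k R w)" for R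
      using xyw inner_bounds by (intro B_nonneg) auto
    have "of_nat n * ennreal (B x y w) = ennreal (n * B x y w)"
      using xyw by (simp add: ennreal_mult' B_nonneg ennreal_of_nat_eq_real_of_nat)
    also have "\<dots> \<le> ennreal ((\<Sum>R\<in>S. B (inner k R x) (inner k R y) (inner k R w)
        + B (x - inner k R x) (y - inner k R y) (w - inner k R w)) + K * (x * y + y * w + x * w))"
      unfolding n_def by (intro ennreal_leI sum_B_cut_ge S xyw)
    also have "\<dots> = (\<Sum>R\<in>S. ennreal (B (inner k R x) (inner k R y) (inner k R w))
        + ennreal (B (x - inner k R x) (y - inner k R y) (w - inner k R w)))
        + ennreal (K * (x * y + y * w + x * w))"
      using xyw K_pos in_nn out_nn
      by (simp add: ennreal_plus sum_nonneg flip: sum_ennreal)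
    finally show "of_nat n * ennreal (B (f (fst z)) (g (snd z - fst z)) (h (snd z))) \<le> (\<Sum>R\<in>S.
        ennreal (B (inner k R (f (fst z))) (inner k R (g (snd z - fst z))) (inner k R (h (snd z)))) +
        ennreal (B (f (fst z) - inner k R (f (fst z))) (g (snd z - fst z) - inner k R (g (snd z - fst z)))
          (h (snd z) - inner k R (h (snd z))))) +
      ennreal (K * (f (fst z) * g (snd z - fst z) + g (snd z - fst z) * h (snd z) + f (fst z) * h (snd z)))"
      by (simp only: x_def y_def w_def)
  qed
  also have "\<dots> = (\<Sum>R\<in>S. I_lborel (\<lambda>x. inner k R (f x)) (\<lambda>x. inner k R (g x)) (\<lambda>x. inner k R (h x))
      + I_lborel (\<lambda>x. f x - inner k R (f x)) (\<lambda>x. g x - inner k R (g x)) (\<lambda>x. h x - inner k R (h x)))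
      + ennreal (K * T)"
    using K_pos unfolding I_lborel_def T_def
    by (subst nn_integral_add, simp, simp, subst nn_integral_pairs[OF fgh], simp,
        subst nn_integral_sum, simp, subst nn_integral_add) simp_all
  \<comment> \<open>Admissibility of \<open>A\<close>, separately for the inner and the outer
    parts.\<close>
  also have "\<dots> \<le> (\<Sum>R\<in>S. ennreal (A * B (inner_mass k R f) (inner_mass k R g) (inner_mass k R h))
      + ennreal (A * B (a - inner_mass k R f) (b - inner_mass k R g) (c - inner_mass k R h)))
      + ennreal (K * T)"
    by (intro add_mono sum_mono I_lborel_le m_in m_out order_refl)
  also have "\<dots> = (\<Sum>R\<in>S. ennreal (X R)) + ennreal (K * T)"
    using Bnn A_pos by (simp add: X_def distrib_left ennreal_plus)
  also have "\<dots> = ennreal ((\<Sum>R\<in>S. X R) + K * T)"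
    using X T K_pos by (simp add: ennreal_plus sum_nonneg)
  finally have "n * J \<le> (\<Sum>R\<in>S. X R) + K * T"
    using X T K_pos by (subst (asm) ennreal_le_iff) (auto intro!: add_nonneg_nonneg sum_nonneg)
  moreover have "(\<Sum>R\<in>S. X R + K * T / n) < (\<Sum>R\<in>S. J)"
    using S XJ by (intro sum_strict_mono) auto
  ultimately show False using n by (simp add: sum.distrib flip: n_def)
qed

end

subsection \<open>Concentration\<close>

lemma AE_lborel_translate:
  fixes P :: "'a::euclidean_space \<Rightarrow> bool"
  assumes "AE x in lborel. P x"
  shows "AE x in lborel. P (x - y)"
proof -
  have "AE x in distr lborel borel ((+) (- y)). P x"
    unfolding lborel_distr_plus by (rule assms)
  then have "AE x in lborel. P (- y + x)"
    by (rule AE_distrD[rotated]) simp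
  then show ?thesis by simp
qed

text \<open>For each fixed \<open>y\<close> the exceptional set of \<open>g\<close> is only
  translated and stays null, so the inner integrals agree for almost every \<open>y\<close>.\<close>

lemma I_form_cong_AE:
  assumes f: "AE x in lborel. f x = f' x" and g: "AE x in lborel. g x = g' x"
    and h: "AE x in lborel. h x = h' x"
  shows "I_form B f g h = I_form B f' g' h'"
  unfolding I_form_def nn_integral_completion
proof (rule nn_integral_cong_AE, use f in eventually_elim)
  fix y assume y: "f y = f' y"
  from AE_lborel_translate[OF g, of y] h
  have "AE x in lborel. ennreal (B (f y) (g (x - y)) (h x)) = ennreal (B (f' y) (g' (x - y)) (h' x))"
    by eventually_elim (simp add: y)
  then show "(\<integral>\<^sup>+x. ennreal (B (f y) (g (x - y)) (h x)) \<partial>lborel) =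
      (\<integral>\<^sup>+x. ennreal (B (f' y) (g' (x - y)) (h' x)) \<partial>lborel)"
    by (rule nn_integral_cong_AE)
qed

lemma dyadic_mass_cong_AE:
  assumes f: "f \<in> borel_measurable lebesgue" "f' \<in> borel_measurable lebesgue"
    and eq: "AE x in lborel. f x = f' x"
  shows "dyadic_mass f = dyadic_mass f'"
proof
  fix j
  note [measurable] = f
  have "{x \<in> space lebesgue. 2 powi j \<le> f x \<and> f x < 2 powi (j + 1)} \<in> sets lebesgue"
      "{x \<in> space lebesgue. 2 powi j \<le> f' x \<and> f' x < 2 powi (j + 1)} \<in> sets lebesgue"
    by measurable
  then have sets: "dyadic_level f j \<in> sets lebesgue" "dyadic_level f' j \<in> sets lebesgue"
    by (simp_all add: dyadic_level_def)
  have "AE x in lebesgue. f x = f' x" using eq by (rule AE_completion)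
  then have "AE x in lebesgue. x \<in> dyadic_level f j \<longleftrightarrow> x \<in> dyadic_level f' j"
    by eventually_elim (simp add: dyadic_level_def)
  then have "emeasure lebesgue (dyadic_level f j) = emeasure lebesgue (dyadic_level f' j)"
    using sets by (rule emeasure_eq_AE)
  then show "dyadic_mass f j = dyadic_mass f' j" by (simp add: dyadic_mass_def)
qed

context convolution_form
begin

text \<open>
  If \<open>g\<close> is only Lebesgue measurable, \<open>(y, x) \<mapsto> g (x - y)\<close> need not be measurable for the product
  \<open>\<sigma>\<close>-algebra, and Tonelli's theorem is not available; hence the passage to Borel functions.
\<close>

lemma nonneg_integrable_borel_version:
  fixes f :: "real ^ 'd \<Rightarrow> real"
  assumes f: "nonneg_integrable f" and a: "integral\<^sup>L lebesgue f = a"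
  obtains f' where "mass_function f' a" "AE x in lborel. f x = f' x" "dyadic_mass f = dyadic_mass f'"
proof -
  have int: "integrable lebesgue f" and nn: "\<And>x. 0 \<le> f x"
    using f by (auto simp: nonneg_integrable_def)
  then have meas: "f \<in> borel_measurable lebesgue" by simp
  then obtain f0 where f0: "f0 \<in> borel_measurable lborel" "AE x in lborel. f x = f0 x"
    using completion_ex_borel_measurable_real by blast
  define f' where "f' x = max 0 (f0 x)" for x
  have [measurable]: "f' \<in> borel_measurable borel" using f0(1) by (simp add: f'_def[abs_def])
  have eq: "AE x in lborel. f x = f' x"
    using f0(2)
  proof eventually_elim
    fix x assume "f x = f0 x"
    then show "f x = f' x" using nn[of x] by (simp add: f'_def)
  qed
  have "(\<integral>\<^sup>+x. ennreal (f' x) \<partial>lborel) = (\<integral>\<^sup>+x. ennreal (f x) \<partial>lborel)"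
    by (rule nn_integral_cong_AE, use eq in eventually_elim) simp
  also have "\<dots> = (\<integral>\<^sup>+x. ennreal (f x) \<partial>lebesgue)" by (simp add: nn_integral_completion)
  also have "\<dots> = ennreal a"
    using nn_integral_eq_integral[OF int] nn a by simp
  finally have "mass_function f' a"
    using integral_nonneg_AE[of f lebesgue] nn a by (simp add: mass_function_def f'_def)
  moreover have "dyadic_mass f = dyadic_mass f'"
    using meas eq by (intro dyadic_mass_cong_AE) (auto intro: measurable_completion)
  ultimately show ?thesis using that eq by blast
qed

section \<open>Quantitative concentration for Borel functions of fixed masses\<close>

context
  fixes \<alpha> \<beta> \<gamma> T B\<^sub>0 :: real
  assumes masses: "0 < \<alpha>" "0 < \<beta>" "0 < \<gamma>"
  defines "T \<equiv> \<alpha> * \<beta> + \<beta> * \<gamma> + \<alpha> * \<gamma>" and "B\<^sub>0 \<equiv> B \<alpha> \<beta> \<gamma>"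
begin

lemma B\<^sub>0_pos: "0 < B\<^sub>0" and T_pos: "0 < T"
  using B_pos[OF masses] masses by (simp_all add: B\<^sub>0_def T_def add_pos_pos)

text \<open>If no three close levels were heavy, the far and the light contributions, each tuned to
  at most a quarter of the assumed lower bound, would have to exceed it. The constants do not depend
  on \<open>f\<close>, \<open>g\<close>, \<open>h\<close>.\<close>

lemma ex_heavy_levels:
  "\<exists>(M::nat) c\<^sub>0. 0 < M \<and> 0 < c\<^sub>0 \<and> (\<forall>f g h. mass_function f \<alpha> \<longrightarrow> mass_function g \<beta> \<longrightarrow> mass_function h \<gamma> \<longrightarrow>
    ennreal (A * B\<^sub>0 / 2) \<le> I_lborel f g h \<longrightarrow>
    (\<exists>k k' k''. \<bar>k - k'\<bar> + \<bar>k - k''\<bar> \<le> int M \<and> ennreal c\<^sub>0 \<le> dyadic_mass f k \<and>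
      ennreal c\<^sub>0 \<le> dyadic_mass g k' \<and> ennreal c\<^sub>0 \<le> dyadic_mass h k''))"
proof -
  define J where "J = A * B\<^sub>0 / 2"
  have J: "0 < J" using A_pos B\<^sub>0_pos by (simp add: J_def)
  \<comment> \<open>Chosen so that the far contribution \<open>K * T / M\<close> is at most
    \<open>J / 4\<close>.\<close>
  obtain M :: nat where "4 * (K * T) / J < M" using reals_Archimedean2 by blast
  moreover have "0 < 4 * (K * T) / J" using J K_pos T_pos by simp
  ultimately have "0 < real M" by (rule less_trans[rotated])
  then have M: "0 < M" by simp
  have MJ: "4 * (K * T) < J * M"
    using \<open>4 * (K * T) / J < M\<close> J by (simp add: field_simps)
  \<comment> \<open>The light contribution is \<open>E * c\<^sub>0\<close>; the choice of
    \<open>c\<^sub>0\<close> makes it \<open>J / 4\<close>.\<close>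
  define E where "E = K * 3 * 2 ^ (M + 1) * (2 * (2 * real M + 1) * (2 * \<alpha> + \<gamma>))"
  have E: "0 < E" using K_pos masses by (simp add: E_def)
  define c\<^sub>0 where "c\<^sub>0 = J / (4 * E)"
  have c: "0 < c\<^sub>0" using J E by (simp add: c\<^sub>0_def)
  have "\<exists>k k' k''. \<bar>k - k'\<bar> + \<bar>k - k''\<bar> \<le> int M \<and> ennreal c\<^sub>0 \<le> dyadic_mass f k \<and>
      ennreal c\<^sub>0 \<le> dyadic_mass g k' \<and> ennreal c\<^sub>0 \<le> dyadic_mass h k''"
    if fgh: "mass_function f \<alpha>" "mass_function g \<beta>" "mass_function h \<gamma>"
      and I: "ennreal J \<le> I_lborel f g h" for f g h
  proof (rule ccontr)
    assume "\<not> ?thesis"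
    then have light: "\<And>k k' k''. \<bar>k - k'\<bar> + \<bar>k - k''\<bar> \<le> int M \<Longrightarrow>
        dyadic_mass f k < ennreal c\<^sub>0 \<or> dyadic_mass g k' < ennreal c\<^sub>0 \<or> dyadic_mass h k'' < ennreal c\<^sub>0"
      by (meson not_le)
    have "I_lborel f g h \<le> ennreal (K / M * (\<alpha> * \<beta> + \<beta> * \<gamma> + \<alpha> * \<gamma>) +
        K * 3 * 2 ^ (M + 1) * (2 * (2 * real M + 1) * c\<^sub>0 * (2 * \<alpha> + \<gamma>)))"
      using M c by (intro I_lborel_le_if_light fgh light) auto
    also have "K / M * (\<alpha> * \<beta> + \<beta> * \<gamma> + \<alpha> * \<gamma>) = K * T / M" by (simp add: T_def)
    also have "K * 3 * 2 ^ (M + 1) * (2 * (2 * real M + 1) * c\<^sub>0 * (2 * \<alpha> + \<gamma>)) = E * c\<^sub>0"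
      by (simp add: E_def mult_ac)
    finally have "ennreal J \<le> ennreal (K * T / M + E * c\<^sub>0)" using I by (rule order_trans[rotated])
    then have "J \<le> K * T / M + E * c\<^sub>0"
      using K_pos T_pos E c M by (subst (asm) ennreal_le_iff) auto
    moreover have "K * T / M \<le> J / 4" using M MJ by (simp add: field_simps)
    moreover have "E * c\<^sub>0 = J / 4" using E by (simp add: c\<^sub>0_def)
    ultimately show False using J by simp
  qed
  then show ?thesis using M c unfolding J_def by blast
qed

text \<open>The cut bounds the nearly maximal form by \<open>A\<close> times two values of
  \<open>B\<close> plus an error of order \<open>1 / n\<close>. The loss in
  \<open>B_split_le\<close> is thus at most \<open>\<delta>\<close> plus that error, relative to
  \<open>A * B\<^sub>0\<close>, and it is linear in the outer fractions.\<close>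

lemma ex_small_outer_mass:
  fixes M n :: nat and c\<^sub>0 \<delta> :: real
  assumes fgh: "mass_function f \<alpha>" "mass_function g \<beta>" "mass_function h \<gamma>"
    and I: "ennreal ((1 - \<delta>) * A * B\<^sub>0) \<le> I_lborel f g h"
    and n: "0 < n" and c: "0 < c\<^sub>0" and near: "\<bar>k - k'\<bar> + \<bar>k - k''\<bar> \<le> int M"
    and heavy: "ennreal c\<^sub>0 \<le> dyadic_mass f k" "ennreal c\<^sub>0 \<le> dyadic_mass g k'"
      "ennreal c\<^sub>0 \<le> dyadic_mass h k''"
  defines "D \<equiv> (\<alpha> + \<beta> + \<gamma>) ^ 2 * C / (\<epsilon> * c\<^sub>0) * (\<delta> + K * T / (n * (A * B\<^sub>0)))"
  obtains R where "R \<le> M + n" "\<alpha> - inner_mass k R f \<le> D" "\<beta> - inner_mass k R g \<le> D"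
    "\<gamma> - inner_mass k R h \<le> D"
proof -
  \<comment> \<open>Radii start above \<open>M\<close>, so that all three heavy levels are inner
    although the centre is \<open>k\<close> for each function.\<close>
  have "{M + 1..M + n} \<noteq> {}" using n by simp
  then obtain R where R: "R \<in> {M + 1..M + n}"
    and IR: "I_lborel f g h \<le> ennreal (A * (B (inner_mass k R f) (inner_mass k R g) (inner_mass k R h)
      + B (\<alpha> - inner_mass k R f) (\<beta> - inner_mass k R g) (\<gamma> - inner_mass k R h)) + K * T / n)"
    using I_lborel_cut[OF fgh, of "{M + 1..M + n}" k] unfolding T_def by auto
  define a where "a = inner_mass k R f"
  define b where "b = inner_mass k R g"
  define d where "d = inner_mass k R h"
  have bounds: "0 \<le> a" "a \<le> \<alpha>" "0 \<le> b" "b \<le> \<beta>" "0 \<le> d" "d \<le> \<gamma>"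
    using fgh[THEN mass_function_inner(3)] fgh[THEN mass_function_inner(4)]
    by (auto simp: a_def b_def d_def)
  have lower: "c\<^sub>0 \<le> a" "c\<^sub>0 \<le> b" "c\<^sub>0 \<le> d"
  proof -
    have "ennreal c\<^sub>0 \<le> ennreal a" unfolding a_def
      using R heavy(1) by (rule_tac order_trans[OF _ dyadic_mass_le_inner_mass[OF fgh(1), of k]]) auto
    then show "c\<^sub>0 \<le> a" using bounds by simp
    have "ennreal c\<^sub>0 \<le> ennreal b" unfolding b_def
      using R heavy(2) near by (rule_tac order_trans[OF _ dyadic_mass_le_inner_mass[OF fgh(2), of k']]) auto
    then show "c\<^sub>0 \<le> b" using bounds by simp
    have "ennreal c\<^sub>0 \<le> ennreal d" unfolding d_def
      using R heavy(3) near by (rule_tac order_trans[OF _ dyadic_mass_le_inner_mass[OF fgh(3), of k'']]) auto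
    then show "c\<^sub>0 \<le> d" using bounds by simp
  qed
  define S where "S = \<alpha> + \<beta> + \<gamma>"
  define \<sigma> where "\<sigma> = (1 - a / \<alpha>) + (1 - b / \<beta>) + (1 - d / \<gamma>)"
  have S: "0 < S" "\<alpha> \<le> S" "\<beta> \<le> S" "\<gamma> \<le> S" using masses by (auto simp: S_def)
  have defects: "0 \<le> 1 - a / \<alpha>" "0 \<le> 1 - b / \<beta>" "0 \<le> 1 - d / \<gamma>"
    using bounds masses by auto
  then have le_\<sigma>: "1 - a / \<alpha> \<le> \<sigma>" "1 - b / \<beta> \<le> \<sigma>" "1 - d / \<gamma> \<le> \<sigma>"
    unfolding \<sigma>_def by linarith+
  with defects have \<sigma>: "0 \<le> \<sigma>" by linarith
  have frac: "c\<^sub>0 / S \<le> x / y" if "c\<^sub>0 \<le> x" "y \<le> S" "0 < y" for x y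
    using that c by (intro frac_le) auto
  \<comment> \<open>The loss from \<open>powr_triple_split_le\<close> with
    \<open>\<eta> = c\<^sub>0 / S\<close>, a lower bound for the three inner fractions.\<close>
  define \<kappa> where "\<kappa> = \<epsilon> * (c\<^sub>0 / S) * \<sigma>"
  have \<kappa>: "0 \<le> \<kappa>" using \<epsilon>_pos c S \<sigma> by (simp add: \<kappa>_def)
  have "B a b d + B (\<alpha> - a) (\<beta> - b) (\<gamma> - d) \<le> (1 - \<kappa> / C) * B \<alpha> \<beta> \<gamma>"
  proof (rule B_split_le)
    fix i
    show "(a / \<alpha>) powr s i * (b / \<beta>) powr t i * (d / \<gamma>) powr u i +
        (1 - a / \<alpha>) powr s i * (1 - b / \<beta>) powr t i * (1 - d / \<gamma>) powr u i \<le> 1 - \<kappa>"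
      unfolding \<kappa>_def \<sigma>_def
      using \<epsilon>_le[of i] \<epsilon>_pos exponents[of i] frac lower S masses c bounds
      by (intro powr_triple_split_le) auto
  qed (use masses bounds \<kappa> in auto)
  then have "A * (B a b d + B (\<alpha> - a) (\<beta> - b) (\<gamma> - d)) \<le> A * ((1 - \<kappa> / C) * B\<^sub>0)"
    using A_pos by (simp add: B\<^sub>0_def)
  moreover have "(1 - \<delta>) * A * B\<^sub>0 \<le> A * (B a b d + B (\<alpha> - a) (\<beta> - b) (\<gamma> - d)) + K * T / n"
  proof -
    have "0 \<le> A * (B a b d + B (\<alpha> - a) (\<beta> - b) (\<gamma> - d)) + K * T / n"
      using A_pos K_pos T_pos n bounds by (intro add_nonneg_nonneg mult_nonneg_nonneg B_nonneg) auto
    then show ?thesis using order_trans[OF I IR] by (simp flip: a_def b_def d_def)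
  qed
  ultimately have "(A * B\<^sub>0) * (\<kappa> / C) \<le> (A * B\<^sub>0) * \<delta> + K * T / n" by (simp add: algebra_simps)
  also have "\<dots> = (A * B\<^sub>0) * (\<delta> + K * T / (n * (A * B\<^sub>0)))"
    using A_pos B\<^sub>0_pos n by (simp add: field_simps)
  finally have "\<kappa> / C \<le> \<delta> + K * T / (n * (A * B\<^sub>0))"
    using A_pos B\<^sub>0_pos by (rule_tac mult_left_le_imp_le[of "A * B\<^sub>0"]) auto
  \<comment> \<open>The factor undoes the constants in \<open>\<kappa> / C\<close> and leaves
    \<open>S * \<sigma>\<close>, which dominates every outer mass.\<close>
  then have "S ^ 2 * C / (\<epsilon> * c\<^sub>0) * (\<kappa> / C) \<le> D"
    unfolding D_def S_def using C_ge_1 \<epsilon>_pos c by (intro mult_left_mono) auto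
  moreover have "S ^ 2 * C / (\<epsilon> * c\<^sub>0) * (\<kappa> / C) = S * \<sigma>"
    using C_ge_1 \<epsilon>_pos c S by (simp add: \<kappa>_def power2_eq_square)
  ultimately have S\<sigma>: "S * \<sigma> \<le> D" by simp
  have part: "x - y \<le> D" if "0 < x" "x \<le> S" "1 - y / x \<le> \<sigma>" "0 \<le> 1 - y / x" for x y
  proof -
    have "x - y = x * (1 - y / x)" using that by (simp add: field_simps)
    also have "\<dots> \<le> S * \<sigma>" using that S by (intro mult_mono) auto
    finally show ?thesis using S\<sigma> by simp
  qed
  show ?thesis
  proof (rule that)
    show "R \<le> M + n" using R by simp
    show "\<alpha> - inner_mass k R f \<le> D" "\<beta> - inner_mass k R g \<le> D" "\<gamma> - inner_mass k R h \<le> D"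
      unfolding a_def[symmetric] b_def[symmetric] d_def[symmetric]
      by (rule part[OF masses(1) S(2) le_\<sigma>(1) defects(1)], rule part[OF masses(2) S(3) le_\<sigma>(2) defects(2)],
          rule part[OF masses(3) S(4) le_\<sigma>(3) defects(3)])
  qed
qed

text \<open>The heavy levels are fixed before \<open>m\<close>; only the cutting radius depends on
  \<open>m\<close>. Taking the number of radii proportional to \<open>m\<close> turns the averaging
  error into the decay \<open>L / m\<close>.\<close>

lemma concentration_borel:
  "\<exists>(M::nat) c\<^sub>0 L. 0 < M \<and> 0 < c\<^sub>0 \<and> 0 < L \<and> (\<forall>\<delta> f g h. 0 < \<delta> \<longrightarrow> \<delta> \<le> 1 / 2 \<longrightarrow>
    mass_function f \<alpha> \<longrightarrow> mass_function g \<beta> \<longrightarrow> mass_function h \<gamma> \<longrightarrow>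
    ennreal ((1 - \<delta>) * A * B\<^sub>0) \<le> I_lborel f g h \<longrightarrow>
    (\<exists>k k' k''. \<bar>k - k'\<bar> + \<bar>k - k''\<bar> \<le> int M \<and> ennreal c\<^sub>0 \<le> dyadic_mass f k \<and>
      ennreal c\<^sub>0 \<le> dyadic_mass g k' \<and> ennreal c\<^sub>0 \<le> dyadic_mass h k'' \<and>
      (\<forall>m::nat. 0 < m \<longrightarrow>
        (\<Sum>\<^sub>\<infinity>j\<in>{j. \<bar>j - k\<bar> \<ge> int m}. dyadic_mass f j) \<le> ennreal (L / m + L * \<delta>) \<and>
        (\<Sum>\<^sub>\<infinity>j\<in>{j. \<bar>j - k'\<bar> \<ge> int m}. dyadic_mass g j) \<le> ennreal (L / m + L * \<delta>) \<and>
        (\<Sum>\<^sub>\<infinity>j\<in>{j. \<bar>j - k''\<bar> \<ge> int m}. dyadic_mass h j) \<le> ennreal (L / m + L * \<delta>))))"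
proof -
  obtain M :: nat and c\<^sub>0 where M: "0 < M" and c: "0 < c\<^sub>0"
    and ex: "\<And>f g h. mass_function f \<alpha> \<Longrightarrow> mass_function g \<beta> \<Longrightarrow> mass_function h \<gamma> \<Longrightarrow>
      ennreal (A * B\<^sub>0 / 2) \<le> I_lborel f g h \<Longrightarrow>
      \<exists>k k' k''. \<bar>k - k'\<bar> + \<bar>k - k''\<bar> \<le> int M \<and> ennreal c\<^sub>0 \<le> dyadic_mass f k \<and>
        ennreal c\<^sub>0 \<le> dyadic_mass g k' \<and> ennreal c\<^sub>0 \<le> dyadic_mass h k''"
    using ex_heavy_levels by blast
  define S where "S = \<alpha> + \<beta> + \<gamma>"
  define E where "E = S ^ 2 * C / (\<epsilon> * c\<^sub>0)"
  define F where "F = K * T / (A * B\<^sub>0)"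
  \<comment> \<open>The summands serve the \<open>\<delta>\<close> term, the \<open>1 / m\<close>
    term for large \<open>m\<close>, and the trivial bound for small \<open>m\<close>.\<close>
  define L where "L = E + 2 * E * F + 4 * M * S"
  have S: "0 < S" using masses by (simp add: S_def)
  have E: "0 < E" using S C_ge_1 \<epsilon>_pos c by (simp add: E_def)
  have F: "0 < F" using K_pos T_pos A_pos B\<^sub>0_pos by (simp add: F_def)
  have L: "0 < L" using E F S by (simp add: L_def add_pos_nonneg)
  have "\<exists>k k' k''. \<bar>k - k'\<bar> + \<bar>k - k''\<bar> \<le> int M \<and> ennreal c\<^sub>0 \<le> dyadic_mass f k \<and>
      ennreal c\<^sub>0 \<le> dyadic_mass g k' \<and> ennreal c\<^sub>0 \<le> dyadic_mass h k'' \<and>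
      (\<forall>m::nat. 0 < m \<longrightarrow>
        (\<Sum>\<^sub>\<infinity>j\<in>{j. \<bar>j - k\<bar> \<ge> int m}. dyadic_mass f j) \<le> ennreal (L / m + L * \<delta>) \<and>
        (\<Sum>\<^sub>\<infinity>j\<in>{j. \<bar>j - k'\<bar> \<ge> int m}. dyadic_mass g j) \<le> ennreal (L / m + L * \<delta>) \<and>
        (\<Sum>\<^sub>\<infinity>j\<in>{j. \<bar>j - k''\<bar> \<ge> int m}. dyadic_mass h j) \<le> ennreal (L / m + L * \<delta>))"
    if \<delta>: "0 < \<delta>" "\<delta> \<le> 1 / 2"
      and fgh: "mass_function f \<alpha>" "mass_function g \<beta>" "mass_function h \<gamma>"
      and I: "ennreal ((1 - \<delta>) * A * B\<^sub>0) \<le> I_lborel f g h" for \<delta> f g h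
  proof -
    \<comment> \<open>This is where \<open>\<delta> \<le> 1 / 2\<close> enters.\<close>
    have "A * B\<^sub>0 / 2 \<le> (1 - \<delta>) * A * B\<^sub>0"
      using mult_right_mono[of "1 / 2" "1 - \<delta>" "A * B\<^sub>0"] \<delta> A_pos B\<^sub>0_pos by (simp add: mult_ac)
    then have "ennreal (A * B\<^sub>0 / 2) \<le> I_lborel f g h"
      using I by (meson ennreal_leI order_trans)
    from ex[OF fgh this] obtain k k' k'' where near: "\<bar>k - k'\<bar> + \<bar>k - k''\<bar> \<le> int M"
      and heavy: "ennreal c\<^sub>0 \<le> dyadic_mass f k" "ennreal c\<^sub>0 \<le> dyadic_mass g k'"
        "ennreal c\<^sub>0 \<le> dyadic_mass h k''" by blast
    have "(\<Sum>\<^sub>\<infinity>j\<in>{j. \<bar>j - k\<bar> \<ge> int m}. dyadic_mass f j) \<le> ennreal (L / m + L * \<delta>) \<and>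
        (\<Sum>\<^sub>\<infinity>j\<in>{j. \<bar>j - k'\<bar> \<ge> int m}. dyadic_mass g j) \<le> ennreal (L / m + L * \<delta>) \<and>
        (\<Sum>\<^sub>\<infinity>j\<in>{j. \<bar>j - k''\<bar> \<ge> int m}. dyadic_mass h j) \<le> ennreal (L / m + L * \<delta>)"
      if m: "0 < m" for m :: nat
    proof (cases "m < 4 * M")
      case True
      \<comment> \<open>For small \<open>m\<close> the total mass is already below
        \<open>L / m\<close>.\<close>
      have "S * m \<le> S * (4 * M)" using S True by (intro mult_left_mono) auto
      also have "\<dots> \<le> L" using E F by (simp add: L_def)
      finally have "S \<le> L / m" using m by (simp add: field_simps)
      then have "S \<le> L / m + L * \<delta>" using L \<delta> by (simp add: add_increasing2)
      then have "ennreal \<alpha> \<le> ennreal (L / m + L * \<delta>)" "ennreal \<beta> \<le> ennreal (L / m + L * \<delta>)"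
          "ennreal \<gamma> \<le> ennreal (L / m + L * \<delta>)"
        using masses by (intro ennreal_leI; simp add: S_def)+
      then show ?thesis
        using fgh[THEN infsum_dyadic_mass_le_mass] by (meson order_trans)
    next
      case False
      \<comment> \<open>One \<open>M\<close> is lost since radii start above \<open>M\<close>, the
        other in passing from the centre \<open>k\<close> to \<open>k'\<close> or
        \<open>k''\<close>. Still \<open>n\<close> is at least \<open>m / 2\<close>.\<close>
      define n where "n = m - 2 * M"
      have n: "0 < n" "m \<le> 2 * real n" using False M by (auto simp: n_def)
      define D where "D = E * (\<delta> + K * T / (n * (A * B\<^sub>0)))"
      obtain R where R: "R \<le> M + n" "\<alpha> - inner_mass k R f \<le> D" "\<beta> - inner_mass k R g \<le> D"
          "\<gamma> - inner_mass k R h \<le> D"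
        using ex_small_outer_mass[OF fgh I n(1) c near heavy] unfolding D_def E_def S_def by blast
      have "D = E * \<delta> + E * F / n" by (simp add: D_def F_def field_simps)
      also have "E * F / n \<le> (2 * E * F) / m"
        using n m mult_left_mono[OF n(2), of "E * F"] E F by (simp add: field_simps)
      also have "E * \<delta> + (2 * E * F) / m \<le> L * \<delta> + L / m"
        using E F S \<delta> by (intro add_mono mult_right_mono divide_right_mono) (auto simp: L_def)
      finally have D: "D \<le> L / m + L * \<delta>" by simp
      \<comment> \<open>Levels at distance at least \<open>m\<close> from \<open>k'\<close> or
        \<open>k''\<close> are at distance at least \<open>m - M\<close> from \<open>k\<close>,
        hence outer.\<close>
      have Rm: "int R \<le> int m - int M" using R(1) False by (simp add: n_def)
      have "(\<Sum>\<^sub>\<infinity>j\<in>{j. \<bar>j - k\<bar> \<ge> int m}. dyadic_mass f j) \<le> ennreal (\<alpha> - inner_mass k R f)"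
        using Rm by (intro infsum_dyadic_mass_le_outer_mass[OF fgh(1)]) auto
      moreover have "(\<Sum>\<^sub>\<infinity>j\<in>{j. \<bar>j - k'\<bar> \<ge> int m}. dyadic_mass g j) \<le> ennreal (\<beta> - inner_mass k R g)"
        using Rm near by (intro infsum_dyadic_mass_le_outer_mass[OF fgh(2)]) auto
      moreover have "(\<Sum>\<^sub>\<infinity>j\<in>{j. \<bar>j - k''\<bar> \<ge> int m}. dyadic_mass h j) \<le> ennreal (\<gamma> - inner_mass k R h)"
        using Rm near by (intro infsum_dyadic_mass_le_outer_mass[OF fgh(3)]) auto
      moreover have "ennreal (\<alpha> - inner_mass k R f) \<le> ennreal (L / m + L * \<delta>)"
          "ennreal (\<beta> - inner_mass k R g) \<le> ennreal (L / m + L * \<delta>)"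
          "ennreal (\<gamma> - inner_mass k R h) \<le> ennreal (L / m + L * \<delta>)"
        using R D by (intro ennreal_leI; simp)+
      ultimately show ?thesis by (meson order_trans)
    qed
    then show ?thesis using near heavy by blast
  qed
  then show ?thesis using M c L by blast
qed

end

end

theorem proposition14:
  fixes \<rho> :: "real ^ 'n \<Rightarrow> real"
    and p q r :: "'n \<Rightarrow> real"
    and P :: "'n \<Rightarrow> real \<Rightarrow> real \<Rightarrow> real \<Rightarrow> real"
    and B :: "real \<Rightarrow> real \<Rightarrow> real \<Rightarrow> real"
    and C A \<alpha> \<beta> \<gamma> :: real
  assumes exponents: "\<And>i. 1 < p i \<and> 1 < q i \<and> 1 < r i \<and> 1 / p i + 1 / q i + 1 / r i = 2"
    and P: "\<And>i a b c. 0 \<le> a \<Longrightarrow> 0 \<le> b \<Longrightarrow> 0 \<le> c \<Longrightarrow>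
      P i a b c = a powr (1 / p i) * b powr (1 / q i) * c powr (1 / r i)"
    and B: "\<And>a b c. 0 \<le> a \<Longrightarrow> 0 \<le> b \<Longrightarrow> 0 \<le> c \<Longrightarrow> B a b c = \<rho> (\<chi> i. P i a b c)"
    and B_measurable: "(\<lambda>(a, b, c). B a b c) \<in>
      borel_measurable (restrict_space borel ({0..} \<times> {0..} \<times> {0..}))"
    and \<rho>_nonneg: "\<And>y. (\<forall>i. 0 \<le> y $ i) \<Longrightarrow> 0 \<le> \<rho> y"
    and \<rho>_scaling: "\<And>l y. (\<forall>i. 0 < l $ i) \<Longrightarrow> (\<forall>i. 0 < y $ i) \<Longrightarrow>
      \<rho> (\<chi> i. l $ i * y $ i) \<le> C * Max (range (\<lambda>i. l $ i)) * \<rho> y"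
    and \<rho>_superadditive: "\<And>y z. (\<forall>i. 0 \<le> y $ i) \<Longrightarrow> (\<forall>i. 0 \<le> z $ i) \<Longrightarrow>
      \<rho> y + \<rho> z \<le> \<rho> (y + z)"
    and A: "optimal_constant TYPE('d::finite) B A"
    and masses: "0 < \<alpha>" "0 < \<beta>" "0 < \<gamma>"
  shows "\<exists>(\<delta>\<^sub>0::real) (c\<^sub>0::real) (C\<^sub>0::real) (\<theta> :: real \<Rightarrow> real) (\<Theta> :: real \<Rightarrow> real).
    0 < \<delta>\<^sub>0 \<and> 0 < c\<^sub>0 \<and> 0 < C\<^sub>0 \<and> (\<forall>t>0. 0 < \<theta> t) \<and> (\<forall>\<delta>>0. 0 < \<Theta> \<delta>) \<and>
    (\<theta> \<longlongrightarrow> 0) at_top \<and> (\<Theta> \<longlongrightarrow> 0) (at_right 0) \<and>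
    (\<forall>\<delta> (f :: real ^ 'd \<Rightarrow> real) (g :: real ^ 'd \<Rightarrow> real) (h :: real ^ 'd \<Rightarrow> real).
      0 < \<delta> \<longrightarrow> \<delta> \<le> \<delta>\<^sub>0 \<longrightarrow>
      nonneg_integrable f \<longrightarrow> nonneg_integrable g \<longrightarrow> nonneg_integrable h \<longrightarrow>
      integral\<^sup>L lebesgue f = \<alpha> \<longrightarrow> integral\<^sup>L lebesgue g = \<beta> \<longrightarrow> integral\<^sup>L lebesgue h = \<gamma> \<longrightarrow>
      I_form B f g h \<ge> ennreal ((1 - \<delta>) * A * B \<alpha> \<beta> \<gamma>) \<longrightarrow>
      (\<exists>k k' k'' :: int.
        dyadic_mass f k \<ge> ennreal c\<^sub>0 \<and>
        (\<forall>m::nat. 0 < m \<longrightarrow>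
          (\<Sum>\<^sub>\<infinity>j\<in>{j. \<bar>j - k\<bar> \<ge> int m}. dyadic_mass f j) \<le> ennreal (\<theta> (real m) + \<Theta> \<delta>)) \<and>
        dyadic_mass g k' \<ge> ennreal c\<^sub>0 \<and>
        (\<forall>m::nat. 0 < m \<longrightarrow>
          (\<Sum>\<^sub>\<infinity>j\<in>{j. \<bar>j - k'\<bar> \<ge> int m}. dyadic_mass g j) \<le> ennreal (\<theta> (real m) + \<Theta> \<delta>)) \<and>
        dyadic_mass h k'' \<ge> ennreal c\<^sub>0 \<and>
        (\<forall>m::nat. 0 < m \<longrightarrow>
          (\<Sum>\<^sub>\<infinity>j\<in>{j. \<bar>j - k''\<bar> \<ge> int m}. dyadic_mass h j) \<le> ennreal (\<theta> (real m) + \<Theta> \<delta>)) \<and>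
        real_of_int (\<bar>k - k'\<bar> + \<bar>k - k''\<bar>) \<le> C\<^sub>0))"
proof -
  interpret convolution_form \<rho> "\<lambda>i. 1 / p i" "\<lambda>i. 1 / q i" "\<lambda>i. 1 / r i" B C A "TYPE('d)"
  proof
    fix i
    show "0 < 1 / p i \<and> 1 / p i < 1 \<and> 0 < 1 / q i \<and> 1 / q i < 1 \<and> 0 < 1 / r i \<and> 1 / r i < 1 \<and>
        1 / p i + 1 / q i + 1 / r i = 2"
      using exponents[of i] by auto
  next
    fix a b c :: real assume "0 \<le> a" "0 \<le> b" "0 \<le> c"
    then show "B a b c = \<rho> (\<chi> i. a powr (1 / p i) * b powr (1 / q i) * c powr (1 / r i))"
      by (simp add: B P)
  qed (fact B_measurable \<rho>_nonneg \<rho>_scaling \<rho>_superadditive A)+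
  obtain M :: nat and c\<^sub>0 L where M: "0 < M" and c: "0 < c\<^sub>0" and L: "0 < L"
    and main: "\<And>\<delta> f g h. 0 < \<delta> \<Longrightarrow> \<delta> \<le> 1 / 2 \<Longrightarrow>
      mass_function f \<alpha> \<Longrightarrow> mass_function g \<beta> \<Longrightarrow> mass_function h \<gamma> \<Longrightarrow>
      ennreal ((1 - \<delta>) * A * B \<alpha> \<beta> \<gamma>) \<le> I_lborel f g h \<Longrightarrow>
      \<exists>k k' k''. \<bar>k - k'\<bar> + \<bar>k - k''\<bar> \<le> int M \<and> ennreal c\<^sub>0 \<le> dyadic_mass f k \<and>
        ennreal c\<^sub>0 \<le> dyadic_mass g k' \<and> ennreal c\<^sub>0 \<le> dyadic_mass h k'' \<and>
        (\<forall>m::nat. 0 < m \<longrightarrow>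
          (\<Sum>\<^sub>\<infinity>j\<in>{j. \<bar>j - k\<bar> \<ge> int m}. dyadic_mass f j) \<le> ennreal (L / m + L * \<delta>) \<and>
          (\<Sum>\<^sub>\<infinity>j\<in>{j. \<bar>j - k'\<bar> \<ge> int m}. dyadic_mass g j) \<le> ennreal (L / m + L * \<delta>) \<and>
          (\<Sum>\<^sub>\<infinity>j\<in>{j. \<bar>j - k''\<bar> \<ge> int m}. dyadic_mass h j) \<le> ennreal (L / m + L * \<delta>))"
    using concentration_borel[OF masses] by blast
  have "((\<lambda>t. L / t) \<longlongrightarrow> 0) at_top"
    by (intro tendsto_divide_0[OF tendsto_const] filterlim_at_top_imp_at_infinity filterlim_ident)
  moreover have "((\<lambda>\<delta>. L * \<delta>) \<longlongrightarrow> 0) (at_right 0)"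
    by (auto intro!: tendsto_eq_intros)
  moreover have "\<exists>k k' k'' :: int.
      dyadic_mass f k \<ge> ennreal c\<^sub>0 \<and>
      (\<forall>m::nat. 0 < m \<longrightarrow>
        (\<Sum>\<^sub>\<infinity>j\<in>{j. \<bar>j - k\<bar> \<ge> int m}. dyadic_mass f j) \<le> ennreal (L / real m + L * \<delta>)) \<and>
      dyadic_mass g k' \<ge> ennreal c\<^sub>0 \<and>
      (\<forall>m::nat. 0 < m \<longrightarrow>
        (\<Sum>\<^sub>\<infinity>j\<in>{j. \<bar>j - k'\<bar> \<ge> int m}. dyadic_mass g j) \<le> ennreal (L / real m + L * \<delta>)) \<and>
      dyadic_mass h k'' \<ge> ennreal c\<^sub>0 \<and>
      (\<forall>m::nat. 0 < m \<longrightarrow>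
        (\<Sum>\<^sub>\<infinity>j\<in>{j. \<bar>j - k''\<bar> \<ge> int m}. dyadic_mass h j) \<le> ennreal (L / real m + L * \<delta>)) \<and>
      real_of_int (\<bar>k - k'\<bar> + \<bar>k - k''\<bar>) \<le> real M"
    if \<delta>: "0 < \<delta>" "\<delta> \<le> 1 / 2"
      and fgh: "nonneg_integrable f" "nonneg_integrable g" "nonneg_integrable h"
      and int: "integral\<^sup>L lebesgue f = \<alpha>" "integral\<^sup>L lebesgue g = \<beta>" "integral\<^sup>L lebesgue h = \<gamma>"
      and I: "I_form B f g h \<ge> ennreal ((1 - \<delta>) * A * B \<alpha> \<beta> \<gamma>)"
    for \<delta> :: real and f g h :: "real ^ 'd \<Rightarrow> real"
  proof -
    \<comment> \<open>Borel versions leave the form, the integrals and all dyadic masses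
      unchanged.\<close>
    obtain f' where f': "mass_function f' \<alpha>" "AE x in lborel. f x = f' x" "dyadic_mass f = dyadic_mass f'"
      using nonneg_integrable_borel_version[OF fgh(1) int(1)] by blast
    obtain g' where g': "mass_function g' \<beta>" "AE x in lborel. g x = g' x" "dyadic_mass g = dyadic_mass g'"
      using nonneg_integrable_borel_version[OF fgh(2) int(2)] by blast
    obtain h' where h': "mass_function h' \<gamma>" "AE x in lborel. h x = h' x" "dyadic_mass h = dyadic_mass h'"
      using nonneg_integrable_borel_version[OF fgh(3) int(3)] by blast
    have "I_form B f g h = I_lborel f' g' h'"
      using I_form_cong_AE[OF f'(2) g'(2) h'(2)] I_form_eq_I_lborel[OF f'(1) g'(1) h'(1)] by simp
    then obtain k k' k'' where "\<bar>k - k'\<bar> + \<bar>k - k''\<bar> \<le> int M"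
      "ennreal c\<^sub>0 \<le> dyadic_mass f' k" "ennreal c\<^sub>0 \<le> dyadic_mass g' k'" "ennreal c\<^sub>0 \<le> dyadic_mass h' k''"
      "\<forall>m::nat. 0 < m \<longrightarrow>
          (\<Sum>\<^sub>\<infinity>j\<in>{j. \<bar>j - k\<bar> \<ge> int m}. dyadic_mass f' j) \<le> ennreal (L / m + L * \<delta>) \<and>
          (\<Sum>\<^sub>\<infinity>j\<in>{j. \<bar>j - k'\<bar> \<ge> int m}. dyadic_mass g' j) \<le> ennreal (L / m + L * \<delta>) \<and>
          (\<Sum>\<^sub>\<infinity>j\<in>{j. \<bar>j - k''\<bar> \<ge> int m}. dyadic_mass h' j) \<le> ennreal (L / m + L * \<delta>)"
      using main[OF \<delta> f'(1) g'(1) h'(1)] I by auto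
    moreover from this(1) have "real_of_int (\<bar>k - k'\<bar> + \<bar>k - k''\<bar>) \<le> real M" by linarith
    ultimately show ?thesis unfolding f'(3) g'(3) h'(3) by blast
  qed
  \<comment> \<open>The witnesses are \<open>1 / 2\<close>, the heavy mass \<open>c\<^sub>0\<close>,
    the distance bound \<open>M\<close>, and the functions \<open>L / t\<close> and
    \<open>L * \<delta>\<close>.\<close>
  ultimately show ?thesis
    using M c L
    by (intro exI[of _ "1 / 2"] exI[of _ c\<^sub>0] exI[of _ "real M"] exI[of _ "\<lambda>t. L / t"] exI[of _ "\<lambda>\<delta>. L * \<delta>"])
      simp
qed

end
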